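(* Let $\alpha\in(0,1]$ and let $f\in\mathcal{S}^*_\alpha$, i.e. $f$ is strongly starlike of order $\alpha$. Then the second Hankel determinant $H_{2,1}(F_{f^{-1}}/2)=\Gamma_1\Gamma_3-\Gamma_2^2$ of the logarithmic inverse coefficients of $f$ satisfies $$ |H_{2,1}(F_{f^{-1}}/2)|\le \begin{cases} \dfrac{\alpha^2}{4}, & 0<\alpha<\dfrac15,\\[3mm] \dfrac{\alpha^2(2+5\alpha+15\alpha^2)}{7+30\alpha+35\alpha^2}, & \dfrac15\le\alpha\le\alpha',\\[3mm] \dfrac{\alpha^2}{36}(4+35\alpha^2), & \alpha'<\alpha\le 1, \end{cases} $$ where $\alpha'=0.390595\ldots$ is the unique root in $(0,1)$ of the equation $44+60x+155x^2-1050x^3-1225x^4=0$. The inequality is sharp: for each $\alpha\in(0,1]$ there is a function $f\in\mathcal{S}^*_\alpha$ for which equality holds.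
   Context: Let $\mathbb{D}=\{z\in\mathbb{C}:|z|<1\}$ and let $\mathcal{A}$ be the class of analytic functions $f$ on $\mathbb{D}$ with $f(0)=0$ and $f'(0)=1$, written $f(z)=z+\sum_{n=2}^\infty a_nz^n$. For $\alpha\in(0,1]$, a function $f\in\mathcal{A}$ is called strongly starlike of order $\alpha$ if $$\left|\arg\left(\frac{zf'(z)}{f(z)}\right)\right|<\frac{\pi\alpha}{2}\quad\text{for all } z\in\mathbb{D}$$ (with $f(z)\neq0$ for $z\in\mathbb{D}\setminus\{0\}$, so that $zf'(z)/f(z)$ is analytic on $\mathbb{D}$, non-zero, with value $1$ at $z=0$; $\arg$ is the principal argument). The set of all such functions is denoted $\mathcal{S}^*_\alpha$. These functions are univalent in $\mathbb{D}$. For univalent $f\in\mathcal{A}$ let $f^{-1}$ be the inverse function of $f$, defined for $|w|<1/4$. The logarithmic inverse coefficients $\Gamma_n$, $n\ge1$, of $f$ are defined by $$F_{f^{-1}}(w):=\log\frac{f^{-1}(w)}{w}=2\sum_{n=1}^\infty\Gamma_nw^n,\qquad |w|<1/4,$$ where the branch of the logarithm is the one vanishing at $w=0$. The second Hankel determinant of $F_{f^{-1}}/2$ is $$H_{2,1}(F_{f^{-1}}/2):=\Gamma_1\Gamma_3-\Gamma_2^2=\frac1{48}\left(13a_2^4-12a_2^2a_3-12a_3^2+12a_2a_4\right).$$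
   Formalization: The root is α' = 0.3905945…, so "0.390595…" fails as a decimal prefix; the formal statement takes it as the value rounded to six decimals, |α' − 0.390595| < 5·10⁻⁷. *)

theory Defs
  imports "HOL-Complex_Analysis.Complex_Analysis"
begin

definition normalized_analytic :: "(complex \<Rightarrow> complex) set" where
  "normalized_analytic = {f. f holomorphic_on ball 0 1 \<and> f 0 = 0 \<and> deriv f 0 = 1}"

text \<open>The quotient \<open>z f'(z) / f(z)\<close>, with its removable singularity at the origin filled in
  for normalized \<open>f\<close>.\<close>

definition starlike_quotient :: "(complex \<Rightarrow> complex) \<Rightarrow> complex \<Rightarrow> complex" where
  "starlike_quotient f z = (if z = 0 then 1 else z * deriv f z / f z)"

text \<open>The quotient is required to be non-zero explicitly, because \<open>Arg 0 = 0\<close> by convention.\<close>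

definition strongly_starlike :: "real \<Rightarrow> (complex \<Rightarrow> complex) set" where
  "strongly_starlike \<alpha> =
     {f \<in> normalized_analytic.
        (\<forall>z \<in> ball 0 1 - {0}. f z \<noteq> 0) \<and>
        (\<forall>z \<in> ball 0 1. starlike_quotient f z \<noteq> 0 \<and>
           \<bar>Arg (starlike_quotient f z)\<bar> < pi * \<alpha> / 2)}"

text \<open>\<open>F w = log (f\<inverse>(w) / w)\<close> for \<open>\<bar>w\<bar> < 1/4\<close>, where \<open>f\<inverse>\<close> is the inverse of the univalent
  function \<open>f\<close> on the unit disc and the branch of the logarithm is the one vanishing at \<open>w = 0\<close>.
  For univalent normalized \<open>f\<close>, such a function exists by the Koebe one-quarter theorem, and it is
  unique on the disc \<open>\<bar>w\<bar> < 1/4\<close>; outside that disc its values are irrelevant.\<close>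

definition is_log_inverse :: "(complex \<Rightarrow> complex) \<Rightarrow> (complex \<Rightarrow> complex) \<Rightarrow> bool" where
  "is_log_inverse f F \<longleftrightarrow>
     F holomorphic_on ball 0 (1/4) \<and> F 0 = 0 \<and>
     (\<forall>w \<in> ball 0 (1/4) - {0}. exp (F w) = the_inv_into (ball 0 1) f w / w)"

definition log_inverse :: "(complex \<Rightarrow> complex) \<Rightarrow> complex \<Rightarrow> complex" where
  "log_inverse f = (SOME F. is_log_inverse f F)"

text \<open>The coefficients \<open>\<Gamma>\<^sub>n\<close> in \<open>F w = 2 (\<Sum>n\<ge>1. \<Gamma>\<^sub>n w\<^sup>n)\<close>.\<close>

definition log_inverse_coeff :: "(complex \<Rightarrow> complex) \<Rightarrow> nat \<Rightarrow> complex" where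
  "log_inverse_coeff f n = fps_nth (fps_expansion (log_inverse f) 0) n / 2"

definition log_inverse_hankel :: "(complex \<Rightarrow> complex) \<Rightarrow> complex" where
  "log_inverse_hankel f =
     log_inverse_coeff f 1 * log_inverse_coeff f 3 - (log_inverse_coeff f 2)\<^sup>2"

end

theory Submission
  imports Defs
begin

text \<open>
Write \<open>q = z f'/f\<close>. Membership in the class means \<open>q = ((1 + \<omega>)/(1 - \<omega>)) powr \<alpha>\<close> for a Schwarz function
\<open>\<omega> = b\<^sub>1 z + b\<^sub>2 z\<^sup>2 + b\<^sub>3 z\<^sup>3 + \<dots>\<close>, equivalently \<open>q' (1 - \<omega>\<^sup>2) = 2 \<alpha> \<omega>' q\<close>, and comparing coefficients gives
\<open>H = (\<alpha>\<^sup>2/12) (4 b\<^sub>1 b\<^sub>3 - 3 b\<^sub>2\<^sup>2 - 10 \<alpha> b\<^sub>1\<^sup>2 b\<^sub>2 + K b\<^sub>1\<^sup>4)\<close> with \<open>K = (4 + 35 \<alpha>\<^sup>2)/3\<close>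
(\<open>log_inverse_hankel_formula\<close>). The problem is thus an extremal problem for the first three coefficients
of a Schwarz function.

Schur's algorithm parametrises these coefficients: with \<open>u = |b\<^sub>1|\<^sup>2\<close> and \<open>s = 1 - u\<close> one has \<open>b\<^sub>2 = s x\<close> and
\<open>b\<^sub>3 = s (y - cnj b\<^sub>1 x\<^sup>2)\<close> where \<open>|x| \<le> 1\<close> and \<open>|y| \<le> 1 - |x|\<^sup>2\<close>. The functional becomes a quadratic
polynomial \<open>p(x)\<close> plus the term \<open>4 s b\<^sub>1 y\<close>. The leading coefficient of \<open>p\<close> has modulus
\<open>s (3 + u) \<ge> 4 s |b\<^sub>1|\<close>, so the total is at most \<open>|p(x)| + |lead p| (1 - |x|\<^sup>2)\<close>, and for every quadratic
polynomial this is dominated by the maximum of \<open>|p|\<close> on the unit circle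
(\<open>quadratic_circle_dominates\<close>). This removes \<open>y\<close> and the modulus of \<open>x\<close> at once. After a rotation
there remain two real variables, \<open>u\<close> and the real part \<open>k\<close> of a point of the circle, and
\<open>circle_values_bound\<close> shows that the maximum is at most the larger of \<open>K\<close>, the value at \<open>u = 1\<close>, and the maximum
over \<open>u \<ge> 0\<close> of \<open>S(u) = 3 + (10 \<alpha> - 2) u - (1 + 10 \<alpha> + K) u\<^sup>2\<close>, which is the value at \<open>k = 1\<close>. The parabola
\<open>S\<close> has its vertex at a positive \<open>u\<close> exactly when \<open>\<alpha> > 1/5\<close>, and from then on \<open>max S - K\<close> has the sign of
the quartic polynomial of the theorem; this produces the three ranges of \<open>\<alpha>\<close>. Equality is attained by
\<open>\<omega> = z (z + c)/(1 + c z)\<close> with \<open>c\<^sup>2\<close> equal to the maximising \<open>u\<close>.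

Before any of this the coefficients \<open>\<Gamma>\<^sub>n\<close> must be identified, which requires that \<open>f\<close> is injective and
that its image contains the disc of radius \<open>1/4\<close>. Both follow from \<open>Re q > 0\<close>: writing \<open>f = z exp L\<close>, the
function \<open>\<zeta> + L (exp \<zeta>)\<close>, a logarithm of \<open>f\<close> on the left half-plane, has derivative \<open>q (exp \<zeta>)\<close> and is therefore
injective there, and Harnack's bound for \<open>Re q\<close> integrates along radii to \<open>|f z| \<ge> |z|/(1 + |z|)\<^sup>2\<close>.
Then \<open>- L\<close> composed with the inverse of \<open>f\<close> is the logarithm that defines the \<open>\<Gamma>\<^sub>n\<close>.
\<close>

section \<open>Quadratic polynomials on the disc and on its boundary\<close>

text \<open>Every chord through \<open>x\<close> carries a two-point probability measure on the circle with mean \<open>x\<close>. By the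
power of the point \<open>x\<close>, its variance is \<open>(1 - |x|\<^sup>2) d\<^sup>2\<close>, where \<open>d\<close> is the unit direction of the chord.
The average of the polynomial is therefore its value at \<open>x\<close> plus \<open>c (1 - |x|\<^sup>2) d\<^sup>2\<close>, and the direction is
free: turning the chord until the two terms have the same argument makes the average as large as claimed,
so one of the two endpoints does the job.\<close>

lemma quadratic_circle_dominates:
  fixes a b c x :: complex
  assumes x: "cmod x \<le> 1"
  obtains z where "cmod z = 1"
    and "cmod (a + b * x + c * x\<^sup>2) + cmod c * (1 - (cmod x)\<^sup>2) \<le> cmod (a + b * z + c * z\<^sup>2)"
proof (cases "cmod x = 1")
  case True
  then show ?thesis using that[of x] by simp
next
  case False
  then have x1: "(cmod x)\<^sup>2 < 1"
    using x by (simp add: power_less_one_iff abs_square_less_1)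
  define p where "p z = a + b * z + c * z\<^sup>2" for z
  have phase: "\<exists>e. cmod e = 1 \<and> w = of_real (cmod w) * e" for w :: complex
    by (rule exI[of _ "if w = 0 then 1 else sgn w"]) (simp add: norm_sgn, simp add: sgn_eq)
  obtain e where e: "cmod e = 1" "p x = of_real (cmod (p x)) * e"
    using phase by blast
  obtain e' where e': "cmod e' = 1" "c = of_real (cmod c) * e'"
    using phase by blast
  \<comment> \<open>The chord direction is chosen so that \<open>c d\<^sup>2\<close> has the same argument as \<open>p x\<close>.\<close>
  define d where "d = csqrt (e / e')"
  have d2: "d\<^sup>2 = e / e'" by (simp add: d_def)
  have cd2: "c * d\<^sup>2 = of_real (cmod c) * e"
    using e' unfolding d2 by (metis nonzero_mult_div_cancel_right norm_zero times_divide_eq_right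
        times_divide_eq_left zero_neq_one mult.assoc)
  have nd: "cmod d = 1"
  proof -
    have "(cmod d)\<^sup>2 = 1" using e(1) e'(1) by (simp add: d2 norm_divide flip: norm_power)
    then show ?thesis by (simp add: power2_eq_1_iff) (use norm_ge_zero[of d] in linarith)
  qed
  define \<beta> where "\<beta> = Re (x * cnj d)"
  define D where "D = sqrt (\<beta>\<^sup>2 + 1 - (cmod x)\<^sup>2)"
  have D2: "D\<^sup>2 = \<beta>\<^sup>2 + 1 - (cmod x)\<^sup>2"
    unfolding D_def using x1 zero_le_power2[of \<beta>] by (intro real_sqrt_pow2) linarith
  have Dpos: "D > 0" and D\<beta>: "\<bar>\<beta>\<bar> < D"
    unfolding D_def using x1 zero_le_power2[of \<beta>]
    by (intro real_sqrt_gt_zero real_less_rsqrt; simp only: power2_abs; linarith)+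
  define t s where "t = - \<beta> + D" and "s = - \<beta> - D"
  have ts: "t * s = (cmod x)\<^sup>2 - 1"
    using D2 unfolding t_def s_def by (simp add: algebra_simps power2_eq_square)
  have on_circle: "cmod (x + of_real r * d) = 1" if "r\<^sup>2 + 2 * r * \<beta> = 1 - (cmod x)\<^sup>2" for r
  proof -
    have "(cmod (x + of_real r * d))\<^sup>2 = (cmod x)\<^sup>2 + 2 * r * \<beta> + r\<^sup>2 * (cmod d)\<^sup>2"
      unfolding \<beta>_def cmod_power2 by (simp add: power2_eq_square algebra_simps)
    with that nd have "(cmod (x + of_real r * d))\<^sup>2 = 1" by simp
    then show ?thesis by (metis norm_ge_zero power2_eq_1_iff neg_0_le_iff_le not_one_le_zero)
  qed
  have z1: "cmod (x + of_real t * d) = 1" and z2: "cmod (x + of_real s * d) = 1"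
    by (rule on_circle, use D2 in \<open>simp add: t_def s_def algebra_simps power2_eq_square\<close>)+
  define l m where "l = - s / (2 * D)" and "m = t / (2 * D)"
  have lm: "l \<ge> 0" "m \<ge> 0" "l + m = 1" and bary: "l * t + m * s = 0"
    using Dpos D\<beta> unfolding l_def m_def t_def s_def by (auto simp: field_simps)
  have var: "l * t\<^sup>2 + m * s\<^sup>2 = 1 - (cmod x)\<^sup>2"
  proof -
    have "l * t\<^sup>2 + m * s\<^sup>2 = - (t * s) * ((t - s) / (2 * D))"
      unfolding l_def m_def using Dpos by (simp add: field_simps power2_eq_square)
    also have "(t - s) / (2 * D) = 1" using Dpos by (simp add: t_def s_def)
    finally show ?thesis using ts by simp
  qed
  have "of_real l * p (x + of_real t * d) + of_real m * p (x + of_real s * d)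
      = of_real (l + m) * p x + of_real (l * t + m * s) * (b * d + 2 * c * x * d)
        + of_real (l * t\<^sup>2 + m * s\<^sup>2) * (c * d\<^sup>2)"
    unfolding p_def by (simp add: algebra_simps power2_eq_square)
  also have "\<dots> = of_real (cmod (p x) + cmod c * (1 - (cmod x)\<^sup>2)) * e"
    unfolding lm bary var cd2 by (subst e(2)) (simp add: algebra_simps)
  finally have avg: "cmod (of_real l * p (x + of_real t * d) + of_real m * p (x + of_real s * d))
      = cmod (p x) + cmod c * (1 - (cmod x)\<^sup>2)"
    using x1 e(1) by (simp add: norm_mult del: of_real_add of_real_mult of_real_diff)
  define M where "M = max (cmod (p (x + of_real t * d))) (cmod (p (x + of_real s * d)))"
  have "cmod (p x) + cmod c * (1 - (cmod x)\<^sup>2)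
      \<le> l * cmod (p (x + of_real t * d)) + m * cmod (p (x + of_real s * d))"
    unfolding avg[symmetric] using lm by (intro order.trans[OF norm_triangle_ineq]) (simp add: norm_mult)
  also have "\<dots> \<le> l * M + m * M"
    unfolding M_def using lm by (intro add_mono mult_left_mono) auto
  also have "\<dots> = M" using lm(3) by (metis mult_1 distrib_right)
  finally show ?thesis
    using that[OF z1] that[OF z2] unfolding M_def p_def by (auto simp: max_def split: if_splits)
qed


section \<open>The extremal problem in two real variables\<close>

text \<open>The left-hand side is convex in \<open>u\<close>, so on \<open>[l, 1]\<close> it is at most its larger endpoint value.\<close>

lemma quadratic_plus_inverse_le_endpoints:
  fixes A B C D l u T :: real
  assumes "C \<ge> 0" "D \<ge> 0" "0 \<le> l" "l \<le> u" "u \<le> 1"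
    and l: "A + B * l + C * l\<^sup>2 + D / (3 + l) \<le> T"
    and r: "A + B + C + D / 4 \<le> T"
  shows "A + B * u + C * u\<^sup>2 + D / (3 + u) \<le> T"
proof (cases "l = 1")
  case True
  then show ?thesis using assms by auto
next
  case False
  define f where "f v = A + B * v + C * v\<^sup>2 + D / (3 + v)" for v
  have frac: "(1 - l) * (D / (3 + u)) = (1 - u) * (D / (3 + l)) + (u - l) * (D / 4)
      - (1 - l) * (u - l) * (1 - u) * (D / (4 * (3 + l) * (3 + u)))"
    using assms by (simp add: divide_simps) (simp add: algebra_simps)
  have "(1 - l) * f u = (1 - u) * f l + (u - l) * f 1
      - (1 - l) * (u - l) * (1 - u) * (C + D / (4 * (3 + l) * (3 + u)))"
    using frac unfolding f_def by (simp add: ring_distribs) (simp add: algebra_simps power2_eq_square)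
  also have "\<dots> \<le> (1 - u) * f l + (u - l) * f 1"
    using assms by simp
  also have "\<dots> \<le> (1 - u) * T + (u - l) * T"
    using assms unfolding f_def by (intro add_mono mult_left_mono) auto
  also have "\<dots> = (1 - l) * T" by (simp add: algebra_simps)
  finally show ?thesis using False assms unfolding f_def by (simp add: mult_le_cancel_left)
qed

text \<open>The left-hand side is a concave quadratic in \<open>k\<close>, and the bound is its value at the vertex.
Stating it through \<open>m\<close> avoids dividing by \<open>R P\<close>, which may vanish.\<close>

lemma square_completion_bound:
  fixes P Q R m k :: real
  assumes "P * R \<ge> 0" "m \<ge> 0" and Q: "Q\<^sup>2 = 4 * R * P * m"
  shows "(R + P)\<^sup>2 + Q\<^sup>2 - 4 * R * P * k\<^sup>2 + 2 * Q * (P - R) * k \<le> (R + P)\<^sup>2 * (1 + m)"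
proof -
  define A d where "A = 4 * R * P" and "d = P - R"
  have A: "A \<ge> 0" "Q\<^sup>2 = A * m" using assms by (auto simp: A_def mult.commute)
  have "0 \<le> A * k\<^sup>2 - 2 * Q * d * k + m * d\<^sup>2"
  proof (cases "A = 0")
    case True
    then show ?thesis using A assms(2) by auto
  next
    case False
    have "A * (A * k\<^sup>2 - 2 * Q * d * k + m * d\<^sup>2) = (A * k - Q * d)\<^sup>2"
      using A(2) by (simp add: power2_eq_square algebra_simps)
    then show ?thesis using False A(1) 
      by (metis order_le_less zero_le_mult_iff zero_le_power2 mult_le_0_iff not_le)
  qed
  also have "A * k\<^sup>2 - 2 * Q * d * k + m * d\<^sup>2
      = (R + P)\<^sup>2 * (1 + m) - ((R + P)\<^sup>2 + Q\<^sup>2 - 4 * R * P * k\<^sup>2 + 2 * Q * (P - R) * k)"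
    unfolding Q unfolding A_def d_def by (simp add: power2_eq_square algebra_simps)
  finally show ?thesis by simp
qed

text \<open>The next three inequalities say that the convex majorant \<open>\<phi>\<close> used in \<open>circle_values_bound\<close> does not
exceed the claimed maximum at a left endpoint \<open>l\<close>, taken as \<open>0\<close>, \<open>\<alpha>\<close> or \<open>1/5\<close> according to the size of
\<open>\<alpha>\<close>. The endpoint must be large enough for this to hold, and small enough for the vertex in \<open>k\<close> to lie
to the right of \<open>1\<close> whenever \<open>0 < u < l\<close>.\<close>

lemma interior_bound_at_zero:
  fixes \<alpha> K :: real
  assumes "21 / 100 \<le> \<alpha>\<^sup>2" and K: "K = (4 + 35 * \<alpha>\<^sup>2) / 3"
  shows "3 * (1 + 25 * \<alpha>\<^sup>2 / (6 * K)) \<le> K"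
proof -
  have K2: "35 * \<alpha>\<^sup>2 = 3 * K - 4" using K by simp
  have Kg: "K \<ge> 377 / 100" using assms by simp
  have "0 \<le> (K - 377/100) * (K - 1/3)" using Kg by (intro mult_nonneg_nonneg) auto
  also have "\<dots> = K * K - 1231/300 * K + 377/300" by (simp add: field_simps)
  finally have "18 * K + 75 * \<alpha>\<^sup>2 \<le> 6 * (K * K)"
    using Kg K2 by linarith
  then show ?thesis using Kg by (simp add: field_simps)
qed

lemma interior_bound_at_alpha:
  fixes \<alpha> K :: real
  assumes a: "0 < \<alpha>" "\<alpha> \<le> 1 / 5" and K: "K = (4 + 35 * \<alpha>\<^sup>2) / 3"
  shows "(3 - 2 * \<alpha> + (K - 1) * \<alpha>\<^sup>2) * (1 + 25 * \<alpha>\<^sup>2 * (1 - \<alpha>) / (2 * K * (3 + \<alpha>))) \<le> 3"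
proof -
  have Kp: "K > 0" unfolding K by (simp add: add_pos_nonneg)
  have pw: "\<alpha> ^ 3 \<le> 1/125" "\<alpha> ^ 4 \<le> 1/625" "\<alpha> ^ 5 \<le> 1/3125"
    using a power_mono[of \<alpha> "1/5" 3] power_mono[of \<alpha> "1/5" 4] power_mono[of \<alpha> "1/5" 5]
    by (simp_all add: power_divide)
  have "0 \<le> \<alpha>^2" "0 \<le> \<alpha>^6" using a by simp_all
  then have "0 \<le> 16 - 217/3 * \<alpha> + 2377/9 * \<alpha>^2 - 385/3 * \<alpha>^3 - 275/9 * \<alpha>^4 - 3325/3 * \<alpha>^5
      + 175/9 * \<alpha>^6"
    using pw a by linarith
  then have "0 \<le> \<alpha> * (16 - 217/3 * \<alpha> + 2377/9 * \<alpha>^2 - 385/3 * \<alpha>^3 - 275/9 * \<alpha>^4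
      - 3325/3 * \<alpha>^5 + 175/9 * \<alpha>^6)"
    using a by simp
  also have "\<dots> = 3 * (2 * K * (3 + \<alpha>))
      - (3 - 2 * \<alpha> + (K - 1) * \<alpha>\<^sup>2) * (2 * K * (3 + \<alpha>) + 25 * \<alpha>\<^sup>2 * (1 - \<alpha>))"
    unfolding K by (simp add: field_simps power2_eq_square power3_eq_cube eval_nat_numeral)
  finally have "(3 - 2 * \<alpha> + (K - 1) * \<alpha>\<^sup>2)
      * ((2 * K * (3 + \<alpha>) + 25 * \<alpha>\<^sup>2 * (1 - \<alpha>)) / (2 * K * (3 + \<alpha>))) \<le> 3"
    using Kp a by (simp add: pos_divide_le_eq)
  also have "(2 * K * (3 + \<alpha>) + 25 * \<alpha>\<^sup>2 * (1 - \<alpha>)) / (2 * K * (3 + \<alpha>))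
      = 1 + 25 * \<alpha>\<^sup>2 * (1 - \<alpha>) / (2 * K * (3 + \<alpha>))"
    using Kp a by (subst add_divide_distrib) simp
  finally show ?thesis .
qed

text \<open>Three lower bounds of \<open>B\<close> are needed in turn as \<open>\<alpha>\<close> grows: the value \<open>3\<close> of \<open>S\<close> at \<open>0\<close>, the value of \<open>S\<close> at
\<open>1/10\<close>, a point close to its vertex for these \<open>\<alpha>\<close>, and \<open>K\<close>.\<close>

lemma interior_bound_at_fifth:
  fixes \<alpha> K B :: real
  assumes a: "1 / 5 \<le> \<alpha>" "\<alpha>\<^sup>2 \<le> 21 / 100" and K: "K = (4 + 35 * \<alpha>\<^sup>2) / 3"
    and B3: "3 \<le> B" and BK: "K \<le> B"
    and B10: "3 + (10 * \<alpha> - 2) / 10 - (1 + 10 * \<alpha> + K) / 100 \<le> B"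
  shows "(3 - 2 * (1/5) + (K - 1) * (1/5)\<^sup>2)
      * (1 + 25 * \<alpha>\<^sup>2 * (1 - 1/5) / (2 * K * (3 + 1/5))) \<le> B"
proof -
  have Kp: "K > 0" unfolding K by (simp add: add_pos_nonneg)
  have lhs: "(3 - 2 * (1/5) + (K - 1) * (1/5)\<^sup>2)
      * (1 + 25 * \<alpha>\<^sup>2 * (1 - 1/5) / (2 * K * (3 + 1/5)))
      = (64/25 + K/25) * (K + 25/8 * \<alpha>\<^sup>2) / K"
    using Kp by (simp add: field_simps power2_eq_square)
  have key: "?thesis" if "X \<le> B" "(64/25 + K/25) * (K + 25/8 * \<alpha>\<^sup>2) \<le> X * K" for X
    unfolding lhs using order.trans[OF that(2) mult_right_mono[OF that(1)]] Kp
    by (simp add: pos_divide_le_eq)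
  have a4: "\<alpha>^4 = \<alpha>\<^sup>2 * \<alpha>\<^sup>2" by (simp add: eval_nat_numeral)
  consider "\<alpha> \<le> 31/100" | "31/100 \<le> \<alpha>" "\<alpha> \<le> 2/5" | "2/5 \<le> \<alpha>" by linarith
  then show ?thesis
  proof cases
    case 1
    have "\<alpha>\<^sup>2 \<le> (31/100)\<^sup>2" "\<alpha>^4 \<le> (31/100)^4"
      using 1 a by (intro power_mono; simp)+
    then have "0 \<le> 116/225 - 77/18 * \<alpha>\<^sup>2 - 497/72 * \<alpha>^4"
      by (simp add: power_divide)
    also have "\<dots> = 3 * K - (64/25 + K/25) * (K + 25/8 * \<alpha>\<^sup>2)"
      unfolding K a4 by (simp add: field_simps)
    finally show ?thesis using key[OF B3] by simp
  next
    case 2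
    have sq: "\<alpha>\<^sup>2 \<le> 71/100 * \<alpha> - 124/1000"
    proof -
      have "0 \<le> (\<alpha> - 31/100) * (2/5 - \<alpha>)" using 2 by simp
      also have "\<dots> = 71/100 * \<alpha> - 124/1000 - \<alpha>\<^sup>2" by (simp add: field_simps power2_eq_square)
      finally show ?thesis by simp
    qed
    \<comment> \<open>The tangent to the cube at \<open>37/100\<close>; the square above is bounded by its chord.\<close>
    have cube: "\<alpha> ^ 3 \<ge> 4107/10000 * \<alpha> - 101306/1000000"
    proof -
      have "0 \<le> (\<alpha> - 37/100)\<^sup>2 * (\<alpha> + 74/100)" using 2 by simp
      also have "\<dots> = \<alpha>^3 - 4107/10000 * \<alpha> + 101306/1000000"
        by (simp add: field_simps power2_eq_square power3_eq_cube)
      finally show ?thesis by simp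
    qed
    have quart: "\<alpha>\<^sup>2 * \<alpha>\<^sup>2 \<le> 5041/10000 * \<alpha>\<^sup>2 - 17608/100000 * \<alpha> + 15376/1000000"
    proof -
      have "\<alpha>\<^sup>2 * \<alpha>\<^sup>2 \<le> (71/100 * \<alpha> - 124/1000) * (71/100 * \<alpha> - 124/1000)"
        using sq by (intro mult_mono) (use 2 in auto)
      also have "\<dots> = 5041/10000 * \<alpha>\<^sup>2 - 17608/100000 * \<alpha> + 15376/1000000"
        by (simp add: field_simps power2_eq_square)
      finally show ?thesis .
    qed
    have "0 \<le> 98/450 + 6/5 * \<alpha> - 1267/180 * \<alpha>\<^sup>2 + 21/2 * \<alpha>^3 - 595/72 * (\<alpha>\<^sup>2 * \<alpha>\<^sup>2)"
      using sq cube quart 2 by linarith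
    also have "\<dots> = (3 + (10 * \<alpha> - 2) / 10 - (1 + 10 * \<alpha> + K) / 100) * K
        - (64/25 + K/25) * (K + 25/8 * \<alpha>\<^sup>2)"
      unfolding K by (simp add: field_simps power3_eq_cube power2_eq_square)
    finally show ?thesis using key[OF B10] by simp
  next
    case 3
    have "(2/5)\<^sup>2 \<le> \<alpha>\<^sup>2" using 3 by (intro power_mono) auto
    then have b: "4/25 \<le> \<alpha>\<^sup>2" by (simp add: power_divide)
    then have "0 \<le> (\<alpha>\<^sup>2 - 4/25) * (3101/24 * \<alpha>\<^sup>2 + 12)"
      by (intro mult_nonneg_nonneg) auto
    also have "\<dots> = 3101/24 * (\<alpha>\<^sup>2 * \<alpha>\<^sup>2) - 3101/150 * \<alpha>\<^sup>2 + 12 * \<alpha>\<^sup>2 - 48/25"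
      by (simp add: field_simps)
    finally have "0 \<le> 3101/24 * (\<alpha>\<^sup>2 * \<alpha>\<^sup>2) - 49/6 * \<alpha>\<^sup>2 - 128/75"
      using b by linarith
    also have "\<dots> = K * K - (64/25 + K/25) * (K + 25/8 * \<alpha>\<^sup>2)"
      unfolding K by (simp add: field_simps)
    finally show ?thesis using key[OF BK] by simp
  qed
qed

text \<open>The inequality \<open>2 K l (3 + l) \<le> 5 \<alpha> (3 - 2 l - (1 + K) l\<^sup>2)\<close> of the next two lemmas expresses that for
\<open>u = l\<close> the vertex in \<open>k\<close> is at least \<open>1\<close>.\<close>

lemma alpha_below_vertex_threshold:
  fixes \<alpha> K :: real
  assumes a: "0 < \<alpha>" "\<alpha> \<le> 1 / 5" and K: "K = (4 + 35 * \<alpha>\<^sup>2) / 3"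
  shows "2 * K * \<alpha> * (3 + \<alpha>) \<le> 5 * \<alpha> * (3 - 2 * \<alpha> - (1 + K) * \<alpha>\<^sup>2)"
proof -
  have pw: "\<alpha> ^ 2 \<le> 1/25" "\<alpha> ^ 3 \<le> 1/125" "\<alpha> ^ 4 \<le> 1/625"
    using a power_mono[of \<alpha> "1/5" 2] power_mono[of \<alpha> "1/5" 3] power_mono[of \<alpha> "1/5" 4]
    by (simp_all add: power_divide)
  have "0 \<le> 7 - 38/3 * \<alpha> - 245/3 * \<alpha>^2 - 70/3 * \<alpha>^3 - 175/3 * \<alpha>^4"
    using pw a by linarith
  then have "0 \<le> \<alpha> * (7 - 38/3 * \<alpha> - 245/3 * \<alpha>^2 - 70/3 * \<alpha>^3 - 175/3 * \<alpha>^4)"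
    using a by simp
  also have "\<dots> = 5 * \<alpha> * (3 - 2 * \<alpha> - (1 + K) * \<alpha>\<^sup>2) - 2 * K * \<alpha> * (3 + \<alpha>)"
    unfolding K by (simp add: field_simps eval_nat_numeral)
  finally show ?thesis by simp
qed

lemma fifth_below_vertex_threshold:
  fixes \<alpha> K :: real
  assumes a: "1 / 5 \<le> \<alpha>" "\<alpha>\<^sup>2 \<le> 21 / 100" and K: "K = (4 + 35 * \<alpha>\<^sup>2) / 3"
  shows "2 * K * (1/5) * (3 + 1/5) \<le> 5 * \<alpha> * (3 - 2 * (1/5) - (1 + K) * (1/5)\<^sup>2)"
proof -
  have "\<alpha>\<^sup>2 \<le> (46/100)\<^sup>2" using a by (simp add: power_divide)
  then have a46: "\<alpha> \<le> 46/100" by (rule power2_le_imp_le) simp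
  have sq: "\<alpha>\<^sup>2 \<le> 66/100 * \<alpha> - 92/1000"
  proof -
    have "0 \<le> (\<alpha> - 1/5) * (46/100 - \<alpha>)" using a a46 by simp
    also have "\<dots> = 66/100 * \<alpha> - 92/1000 - \<alpha>\<^sup>2" by (simp add: field_simps power2_eq_square)
    finally show ?thesis by simp
  qed
  have "\<alpha> * \<alpha>\<^sup>2 \<le> \<alpha> * (66/100 * \<alpha> - 92/1000)"
    using sq a by (intro mult_left_mono) auto
  then have cube: "\<alpha> * \<alpha>\<^sup>2 \<le> 66/100 * \<alpha>\<^sup>2 - 92/1000 * \<alpha>"
    by (simp add: algebra_simps power2_eq_square)
  have "0 \<le> - 128/75 + 188/15 * \<alpha> - 224/15 * \<alpha>\<^sup>2 - 7/3 * (\<alpha> * \<alpha>\<^sup>2)"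
    using sq cube a by linarith
  also have "\<dots> = 5 * \<alpha> * (3 - 2 * (1/5) - (1 + K) * (1/5)\<^sup>2) - 2 * K * (1/5) * (3 + 1/5)"
    unfolding K by (simp add: field_simps power2_eq_square)
  finally show ?thesis by simp
qed

text \<open>The left-hand side is \<open>|R - Q \<eta> - P \<eta>\<^sup>2|\<^sup>2\<close> for \<open>|\<eta>| = 1\<close> and \<open>Re \<eta> = k\<close>, a concave quadratic in \<open>k\<close>. For small
\<open>u\<close> its vertex lies to the right of \<open>1\<close>, so the maximum is at \<open>k = 1\<close> and equals \<open>(P - R + Q)\<^sup>2 = S(u)\<^sup>2\<close>.
For larger \<open>u\<close> the vertex value \<open>(R + P)\<^sup>2 (1 + m)\<close> is used; replacing \<open>sqrt (1 + m)\<close> by \<open>1 + m/2\<close> gives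
a majorant \<open>\<phi>(u)\<close> that is convex, so it suffices to bound it at \<open>u = 1\<close>, where it equals \<open>K\<close>, and at
the point \<open>l\<close> where the two regimes are separated.\<close>

lemma circle_values_bound:
  fixes \<alpha> u k K B P Q R :: real
  assumes a: "0 < \<alpha>" and a1: "\<alpha> \<le> 1" and u: "0 \<le> u" "u \<le> 1" and k: "-1 \<le> k" "k \<le> 1"
    and K: "K = (4 + 35 * \<alpha>\<^sup>2) / 3"
    and PQR: "P = (1 - u) * (3 + u)" "Q = 10 * \<alpha> * u * (1 - u)" "R = K * u\<^sup>2"
    and BK: "K \<le> B"
    and Bq: "\<And>v. 0 \<le> v \<Longrightarrow> 3 + (10 * \<alpha> - 2) * v - (1 + 10 * \<alpha> + K) * v\<^sup>2 \<le> B"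
  shows "(R + P)\<^sup>2 + Q\<^sup>2 - 4 * R * P * k\<^sup>2 + 2 * Q * (P - R) * k \<le> B\<^sup>2"
proof -
  have Kg: "K \<ge> 4/3" and Kp: "K > 0" unfolding K by (simp_all add: add_pos_nonneg)
  have B3: "3 \<le> B" using Bq[of 0] by simp
  have PRQ: "P \<ge> 0" "R \<ge> 0" "Q \<ge> 0" using u a Kg unfolding PQR by auto
  define m where "m = 25 * \<alpha>\<^sup>2 * (1 - u) / (K * (3 + u))"
  have m0: "m \<ge> 0" using u Kg by (simp add: m_def)
  define \<phi> where "\<phi> v = (3 - 2 * v + (K - 1) * v\<^sup>2) * (1 + 25 * \<alpha>\<^sup>2 * (1 - v) / (2 * K * (3 + v)))" for v
  have interior: ?thesis if l: "0 \<le> l" "l \<le> u" and "\<phi> l \<le> B" for l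
  proof -
    define \<delta> where "\<delta> = 25 * \<alpha>\<^sup>2 / (2 * K)"
    have "\<alpha>\<^sup>2 \<le> 1" using a a1 by (simp add: power_le_one)
    then have \<delta>: "0 \<le> \<delta>" "\<delta> \<le> 1"
      using Kp K unfolding \<delta>_def by (simp, subst pos_divide_le_eq) auto
    \<comment> \<open>Partial fractions exhibit convexity: the coefficients of \<open>v\<^sup>2\<close> and \<open>1 / (3 + v)\<close> are nonnegative.\<close>
    have form: "\<phi> v = ((1 - \<delta>) * 3 - 4 * \<delta> * (3 * K - 1)) + (4 * \<delta> * (K - 1) - 2 * (1 - \<delta>)) * v
        + ((1 - \<delta>) * (K - 1)) * v\<^sup>2 + 36 * \<delta> * K / (3 + v)" if "v \<ge> 0" for v
    proof -
      have "25 * \<alpha>\<^sup>2 * (1 - v) / (2 * K * (3 + v)) = \<delta> * ((1 - v) / (3 + v))"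
        by (simp add: \<delta>_def)
      moreover have "(3 - 2 * v + (K - 1) * v\<^sup>2) * (1 + \<delta> * ((1 - v) / (3 + v)))
        = ((1 - \<delta>) * 3 - 4 * \<delta> * (3 * K - 1)) + (4 * \<delta> * (K - 1) - 2 * (1 - \<delta>)) * v
        + ((1 - \<delta>) * (K - 1)) * v\<^sup>2 + 36 * \<delta> * K / (3 + v)"
        using that by (simp add: divide_simps) (simp add: algebra_simps power2_eq_square)
      ultimately show ?thesis by (simp add: \<phi>_def)
    qed
    have "\<phi> u \<le> B"
      unfolding form[OF u(1)]
    proof (rule quadratic_plus_inverse_le_endpoints[OF _ _ l u(2)])
      show "0 \<le> (1 - \<delta>) * (K - 1)" "0 \<le> 36 * \<delta> * K" using \<delta> Kg by simp_all
    next
      show "((1 - \<delta>) * 3 - 4 * \<delta> * (3 * K - 1)) + (4 * \<delta> * (K - 1) - 2 * (1 - \<delta>)) * l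
        + ((1 - \<delta>) * (K - 1)) * l\<^sup>2 + 36 * \<delta> * K / (3 + l) \<le> B"
        using that(3) unfolding form[OF l(1)] .
    next
      have "((1 - \<delta>) * 3 - 4 * \<delta> * (3 * K - 1)) + (4 * \<delta> * (K - 1) - 2 * (1 - \<delta>))
        + ((1 - \<delta>) * (K - 1)) + 36 * \<delta> * K / 4 = K"
        by (simp add: algebra_simps)
      with BK show "((1 - \<delta>) * 3 - 4 * \<delta> * (3 * K - 1)) + (4 * \<delta> * (K - 1) - 2 * (1 - \<delta>))
        + ((1 - \<delta>) * (K - 1)) + 36 * \<delta> * K / 4 \<le> B" by linarith
    qed
    moreover have "\<phi> u = (R + P) * (1 + m / 2)"
      unfolding \<phi>_def PQR m_def by (simp add: algebra_simps power2_eq_square)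
    ultimately have "((R + P) * (1 + m / 2))\<^sup>2 \<le> B\<^sup>2"
      using PRQ m0 by (intro power_mono) auto
    moreover have "(R + P)\<^sup>2 * (1 + m) \<le> ((R + P) * (1 + m / 2))\<^sup>2"
    proof -
      have "(1 + m / 2)\<^sup>2 = 1 + m + (m / 2)\<^sup>2" by (simp add: power2_eq_square field_simps)
      then have "1 + m \<le> (1 + m / 2)\<^sup>2" by simp
      then show ?thesis unfolding power_mult_distrib by (intro mult_left_mono) auto
    qed
    moreover have "Q\<^sup>2 = 4 * R * P * m"
    proof -
      have "4 * R * P * m = 4 * u\<^sup>2 * (1 - u) * (K * (3 + u) * m)"
        unfolding PQR by (simp add: algebra_simps)
      also have "K * (3 + u) * m = 25 * \<alpha>\<^sup>2 * (1 - u)"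
        using u Kp by (simp add: m_def)
      finally show ?thesis unfolding PQR by (simp add: power2_eq_square algebra_simps)
    qed
    ultimately show ?thesis
      using square_completion_bound[of P R m Q k] PRQ m0 by simp
  qed
  \<comment> \<open>Here \<open>2 u s\<close> times the hypothesis, moved from \<open>l\<close> down to \<open>u\<close>, is \<open>4 R P \<le> Q (P - R)\<close>.\<close>
  have vertex: ?thesis if l: "u \<le> l" "2 * K * l * (3 + l) \<le> 5 * \<alpha> * (3 - 2 * l - (1 + K) * l\<^sup>2)" for l
  proof -
    have "2 * K * u * (3 + u) \<le> 2 * K * l * (3 + l)"
      using u l Kg by (intro mult_mono) auto
    moreover have "5 * \<alpha> * (3 - 2 * l - (1 + K) * l\<^sup>2) \<le> 5 * \<alpha> * (3 - 2 * u - (1 + K) * u\<^sup>2)"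
      using u l Kg a by (intro mult_left_mono diff_mono power_mono) auto
    moreover have "P - R = 3 - 2 * u - (1 + K) * u\<^sup>2"
      unfolding PQR by (simp add: algebra_simps power2_eq_square)
    ultimately have *: "2 * K * u * (3 + u) \<le> 5 * \<alpha> * (P - R)"
      using l by simp
    have PR: "0 \<le> P - R"
      using order.trans[OF _ *, of 0] u Kg a by (simp add: zero_le_mult_iff)
    have "0 \<le> 2 * u * (1 - u) * (5 * \<alpha> * (P - R) - 2 * K * u * (3 + u))"
      using * u by simp
    also have "\<dots> = Q * (P - R) - 4 * R * P"
      unfolding PQR by (simp add: algebra_simps power2_eq_square)
    finally have Q: "4 * R * P \<le> Q * (P - R)" by simp
    have "4 * R * P * (1 + k) \<le> 4 * R * P * 2"
      using k PRQ by (intro mult_left_mono) auto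
    with Q have "4 * R * P * (1 + k) \<le> 2 * (Q * (P - R))" by linarith
    with k have "0 \<le> (1 - k) * (2 * (Q * (P - R)) - 4 * R * P * (1 + k))"
      by (intro mult_nonneg_nonneg) linarith+
    then have "(R + P)\<^sup>2 + Q\<^sup>2 - 4 * R * P * k\<^sup>2 + 2 * Q * (P - R) * k \<le> (P - R + Q)\<^sup>2"
      by (simp add: algebra_simps power2_eq_square)
    also have "\<dots> \<le> B\<^sup>2"
    proof (rule power_mono)
      have "P - R + Q = 3 + (10 * \<alpha> - 2) * u - (1 + 10 * \<alpha> + K) * u\<^sup>2"
        unfolding PQR by (simp add: algebra_simps power2_eq_square)
      with Bq[OF u(1)] show "P - R + Q \<le> B" by simp
    qed (use PR PRQ in simp)
    finally show ?thesis .
  qed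
  consider "21/100 \<le> \<alpha>\<^sup>2" | "\<alpha> \<le> 1/5" | "1/5 \<le> \<alpha>" "\<alpha>\<^sup>2 \<le> 21/100" by linarith
  then show ?thesis
  proof cases
    case 1
    then have "\<phi> 0 \<le> K"
      using interior_bound_at_zero[OF 1 K] by (simp add: \<phi>_def)
    then show ?thesis using interior[of 0] u BK by simp
  next
    case 2
    then have "\<phi> \<alpha> \<le> B"
      using interior_bound_at_alpha[OF a 2 K] B3 by (simp add: \<phi>_def)
    then show ?thesis
      using interior[of \<alpha>] vertex[of \<alpha>] alpha_below_vertex_threshold[OF a 2 K] a by linarith
  next
    case 3
    have "3 + (10 * \<alpha> - 2) / 10 - (1 + 10 * \<alpha> + K) / 100 \<le> B"
      using Bq[of "1/10"] by (simp add: power_divide)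
    then have "\<phi> (1/5) \<le> B"
      unfolding \<phi>_def by (rule interior_bound_at_fifth[OF 3 K B3 BK])
    then show ?thesis
      using interior[of "1/5"] vertex[of "1/5"] fifth_below_vertex_threshold[OF 3 K] by linarith
  qed
qed

section \<open>Coefficients of Schwarz functions\<close>

lemma fps_expansion_nth_0 [simp]: "fps_nth (fps_expansion f z) 0 = f z"
  by (simp add: fps_expansion_def)

lemma has_fps_expansion_eventually_eqD:
  fixes f g :: "complex \<Rightarrow> complex"
  assumes "f has_fps_expansion F" "g has_fps_expansion G" "\<forall>\<^sub>F z in nhds 0. f z = g z"
  shows "F = G"
  using has_fps_expansion_cong[OF assms(3) refl, THEN iffD1, OF assms(1)] assms(2)
  by (rule fps_expansion_unique_complex)

text \<open>Composing \<open>\<phi>\<close> with the Moebius map that sends \<open>\<phi> 0\<close> to \<open>0\<close> and dividing by \<open>z\<close> preserves the bound \<open>1\<close>, by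
the Schwarz lemma. The relation between \<open>\<phi>\<close> and the new function \<open>\<psi>\<close> is recorded without denominators, so
that it remains true, with \<open>\<psi> = 0\<close>, when \<open>\<phi>\<close> is a unimodular constant.\<close>

lemma schur_step:
  assumes hol: "\<phi> holomorphic_on ball 0 1" and le: "\<And>z. cmod z < 1 \<Longrightarrow> cmod (\<phi> z) \<le> 1"
  obtains \<psi> where "\<psi> holomorphic_on ball 0 1" "\<And>z. cmod z < 1 \<Longrightarrow> cmod (\<psi> z) \<le> 1"
    "fps_expansion \<phi> 0 - fps_const (\<phi> 0) =
       fps_X * fps_expansion \<psi> 0 * (1 - fps_const (cnj (\<phi> 0)) * fps_expansion \<phi> 0)"
proof -
  have "\<exists>\<psi>. \<psi> holomorphic_on ball 0 1 \<and> (\<forall>z. cmod z < 1 \<longrightarrow> cmod (\<psi> z) \<le> 1) \<and>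
      (\<forall>z. cmod z < 1 \<longrightarrow> \<phi> z - \<phi> 0 = z * \<psi> z * (1 - cnj (\<phi> 0) * \<phi> z))"
  proof (cases "\<exists>w. cmod w < 1 \<and> cmod (\<phi> w) = 1")
    case True
    then obtain w where w: "cmod w < 1" "cmod (\<phi> w) = 1" by blast
    have "\<phi> constant_on ball 0 1"
      by (rule maximum_modulus_principle[OF hol, of "ball 0 1" w]) (use w le in auto)
    then have "\<phi> z - \<phi> 0 = 0" if "cmod z < 1" for z
      using that by (auto simp: constant_on_def)
    note const = this
    show ?thesis
    proof (intro exI[of _ "\<lambda>_. 0"] conjI allI impI)
      fix z :: complex assume "cmod z < 1"
      from const[OF this] show "\<phi> z - \<phi> 0 = z * 0 * (1 - cnj (\<phi> 0) * \<phi> z)"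
        by (simp only: mult_zero_left mult_zero_right)
    qed auto
  next
    case False
    with le have lt: "cmod (\<phi> z) < 1" if "cmod z < 1" for z
      using that by (metis order_le_less)
    have den: "1 - cnj (\<phi> 0) * \<phi> z \<noteq> 0" if "cmod z < 1" for z
    proof
      assume "1 - cnj (\<phi> 0) * \<phi> z = 0"
      then have "cmod (\<phi> 0) * cmod (\<phi> z) = 1"
        by (metis complex_mod_cnj eq_iff_diff_eq_0 norm_mult norm_one)
      moreover have "cmod (\<phi> 0) * cmod (\<phi> z) < 1 * 1"
        using lt[of 0] lt[OF that] by (intro mult_strict_mono') auto
      ultimately show False by simp
    qed
    define M where "M z = (\<phi> z - \<phi> 0) / (1 - cnj (\<phi> 0) * \<phi> z)" for z
    have holM: "M holomorphic_on ball 0 1"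
      unfolding M_def using den by (intro holomorphic_intros hol) auto
    have ltM: "cmod (M z) < 1" if "cmod z < 1" for z
      using Moebius_function_norm_lt_1[OF lt[of 0] lt[OF that], of 0]
      by (simp add: Moebius_function_def M_def)
    have M0: "M 0 = 0" by (simp add: M_def)
    obtain h where h: "h holomorphic_on ball 0 1" "\<And>z. cmod z < 1 \<Longrightarrow> M z = z * h z" "deriv M 0 = h 0"
      using Schwarz3[OF holM M0] by blast
    have "cmod (h z) \<le> 1" if z: "cmod z < 1" for z
    proof (cases "z = 0")
      case True
      then show ?thesis using Schwarz_Lemma(2)[OF holM M0 ltM, of 0] h(3) by simp
    next
      case False
      then show ?thesis using Schwarz_Lemma(1)[OF holM M0 ltM z] h(2)[OF z] by (simp add: norm_mult)
    qed
    moreover have "\<phi> z - \<phi> 0 = z * h z * (1 - cnj (\<phi> 0) * \<phi> z)" if "cmod z < 1" for z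
      unfolding h(2)[OF that, symmetric] M_def using den[OF that] by simp
    ultimately show ?thesis using h(1) by blast
  qed
  then obtain \<psi> where \<psi>: "\<psi> holomorphic_on ball 0 1" "\<And>z. cmod z < 1 \<Longrightarrow> cmod (\<psi> z) \<le> 1"
      "\<And>z. cmod z < 1 \<Longrightarrow> \<phi> z - \<phi> 0 = z * \<psi> z * (1 - cnj (\<phi> 0) * \<phi> z)"
    by blast
  have fps: "\<phi> has_fps_expansion fps_expansion \<phi> 0" "\<psi> has_fps_expansion fps_expansion \<psi> 0"
    using hol \<psi>(1) by (auto intro!: has_fps_expansion_fps_expansion[of "ball 0 1"])
  have "fps_expansion \<phi> 0 - fps_const (\<phi> 0) =
       fps_X * fps_expansion \<psi> 0 * (1 - fps_const (cnj (\<phi> 0)) * fps_expansion \<phi> 0)"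
  proof (rule has_fps_expansion_eventually_eqD)
    show "(\<lambda>z. \<phi> z - \<phi> 0) has_fps_expansion fps_expansion \<phi> 0 - fps_const (\<phi> 0)"
      by (intro fps_expansion_intros fps)
    show "(\<lambda>z. z * \<psi> z * (1 - cnj (\<phi> 0) * \<phi> z)) has_fps_expansion
        fps_X * fps_expansion \<psi> 0 * (1 - fps_const (cnj (\<phi> 0)) * fps_expansion \<phi> 0)"
      by (intro fps_expansion_intros fps)
    show "\<forall>\<^sub>F z in nhds 0. \<phi> z - \<phi> 0 = z * \<psi> z * (1 - cnj (\<phi> 0) * \<phi> z)"
      by (rule eventually_mono[OF eventually_nhds_in_open[of "ball 0 1"]]) (use \<psi>(3) in auto)
  qed
  then show thesis using that[OF \<psi>(1) \<psi>(2)] by blast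
qed

text \<open>Three Schur steps, starting from \<open>\<omega>\<close>: the parameter \<open>x\<close> is the value at \<open>0\<close> of the second Schur iterate,
and \<open>y\<close> its derivative there, which the third step bounds by \<open>1 - |x|\<^sup>2\<close>.\<close>

lemma schwarz_function_coefficients:
  assumes hol: "\<omega> holomorphic_on ball 0 1" and lt: "\<And>z. cmod z < 1 \<Longrightarrow> cmod (\<omega> z) < 1"
    and 0: "\<omega> 0 = 0"
  defines "b \<equiv> fps_nth (fps_expansion \<omega> 0)"
  obtains x y where "cmod (b 1) \<le> 1" "cmod x \<le> 1" "cmod y \<le> 1 - (cmod x)\<^sup>2"
    "b 2 = of_real (1 - (cmod (b 1))\<^sup>2) * x"
    "b 3 = of_real (1 - (cmod (b 1))\<^sup>2) * (y - cnj (b 1) * x\<^sup>2)"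
proof -
  obtain \<phi> where \<phi>: "\<phi> holomorphic_on ball 0 1" "\<And>z. cmod z < 1 \<Longrightarrow> cmod (\<phi> z) \<le> 1"
    "fps_expansion \<omega> 0 = fps_X * fps_expansion \<phi> 0"
    using schur_step[OF hol less_imp_le[OF lt]] 0 by auto
  obtain \<psi> where \<psi>: "\<psi> holomorphic_on ball 0 1" "\<And>z. cmod z < 1 \<Longrightarrow> cmod (\<psi> z) \<le> 1"
    "fps_expansion \<phi> 0 - fps_const (\<phi> 0) =
       fps_X * fps_expansion \<psi> 0 * (1 - fps_const (cnj (\<phi> 0)) * fps_expansion \<phi> 0)"
    using schur_step[OF \<phi>(1,2)] by blast
  obtain \<kappa> where \<kappa>: "\<kappa> holomorphic_on ball 0 1" "\<And>z. cmod z < 1 \<Longrightarrow> cmod (\<kappa> z) \<le> 1"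
    "fps_expansion \<psi> 0 - fps_const (\<psi> 0) =
       fps_X * fps_expansion \<kappa> 0 * (1 - fps_const (cnj (\<psi> 0)) * fps_expansion \<psi> 0)"
    using schur_step[OF \<psi>(1,2)] by blast
  have b: "b (Suc n) = fps_nth (fps_expansion \<phi> 0) n" for n
    unfolding b_def \<phi>(3) by simp
  have b1: "b 1 = \<phi> 0" using b[of 0] by simp
  have sq: "1 - cnj w * w = of_real (1 - (cmod w)\<^sup>2)" for w
    unfolding of_real_diff complex_norm_square by (simp add: mult.commute)
  have \<phi>n: "fps_nth (fps_expansion \<phi> 0) (Suc n) =
      fps_nth (fps_expansion \<psi> 0 * (1 - fps_const (cnj (\<phi> 0)) * fps_expansion \<phi> 0)) n" for n
    using arg_cong[OF \<psi>(3), of "\<lambda>F. fps_nth F (Suc n)"] by (simp add: mult.assoc)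
  have \<psi>1: "fps_nth (fps_expansion \<psi> 0) 1 = \<kappa> 0 * of_real (1 - (cmod (\<psi> 0))\<^sup>2)"
    using arg_cong[OF \<kappa>(3), of "\<lambda>F. fps_nth F (Suc 0)"] sq[of "\<psi> 0"] by (simp add: mult.assoc)
  show thesis
  proof (rule that[of "\<psi> 0" "fps_nth (fps_expansion \<psi> 0) 1"])
    show "cmod (b 1) \<le> 1" "cmod (\<psi> 0) \<le> 1" using \<phi>(2) \<psi>(2) b1 by auto
    have "cmod (fps_nth (fps_expansion \<psi> 0) 1) = cmod (\<kappa> 0) * (1 - (cmod (\<psi> 0))\<^sup>2)"
      unfolding \<psi>1 norm_mult norm_of_real using \<psi>(2)[of 0] by (simp add: power_le_one)
    also have "\<dots> \<le> 1 * (1 - (cmod (\<psi> 0))\<^sup>2)"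
      using \<kappa>(2)[of 0] \<psi>(2)[of 0] by (intro mult_right_mono) (auto simp: power_le_one)
    finally show "cmod (fps_nth (fps_expansion \<psi> 0) 1) \<le> 1 - (cmod (\<psi> 0))\<^sup>2" by simp
    have b2: "b 2 = \<psi> 0 * of_real (1 - (cmod (b 1))\<^sup>2)"
      using b[of 1] \<phi>n[of 0] sq[of "b 1"] b1 by (simp add: numeral_2_eq_2)
    then show "b 2 = of_real (1 - (cmod (b 1))\<^sup>2) * \<psi> 0" by (simp only: mult.commute)
    have "b 3 = fps_nth (fps_expansion \<psi> 0) 1 * (1 - cnj (b 1) * b 1) - \<psi> 0 * cnj (b 1) * b 2"
      using b[of 2] b[of 1] \<phi>n[of 1] b1 by (simp add: fps_mult_nth numeral_2_eq_2 numeral_3_eq_3)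
    then show "b 3 = of_real (1 - (cmod (b 1))\<^sup>2)
        * (fps_nth (fps_expansion \<psi> 0) 1 - cnj (b 1) * (\<psi> 0)\<^sup>2)"
      unfolding b2 sq by (simp add: algebra_simps power2_eq_square)
  qed
qed

lemma cmod_quadratic_on_circle:
  fixes P Q R :: real
  assumes "cmod \<eta> = 1"
  shows "(cmod (of_real R - of_real Q * \<eta> - of_real P * \<eta>\<^sup>2))\<^sup>2
    = (R + P)\<^sup>2 + Q\<^sup>2 - 4 * R * P * (Re \<eta>)\<^sup>2 + 2 * Q * (P - R) * Re \<eta>"
proof -
  define k h where "k = Re \<eta>" and "h = Im \<eta>"
  have h: "h * h = 1 - k * k"
    using assms cmod_power2[of \<eta>] by (simp add: k_def h_def power2_eq_square)
  have h': "h * (h * w) = (1 - k * k) * w" for w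
    using h by (metis mult.assoc)
  show ?thesis
    unfolding cmod_power2
    by (simp add: power2_eq_square algebra_simps h h' flip: k_def h_def)
qed


section \<open>Geometry of strongly starlike functions\<close>

lemma strongly_starlike_log_quotient:
  assumes f: "f \<in> strongly_starlike \<alpha>"
  obtains L where "L holomorphic_on ball 0 1" "L 0 = 0"
    "\<And>z. cmod z < 1 \<Longrightarrow> f z = z * exp (L z)"
    "\<And>z. cmod z < 1 \<Longrightarrow> starlike_quotient f z = 1 + z * deriv L z"
proof -
  have hol: "f holomorphic_on ball 0 1" and f0: "f 0 = 0" and f1: "deriv f 0 = 1"
    and nz: "\<And>z. cmod z < 1 \<Longrightarrow> z \<noteq> 0 \<Longrightarrow> f z \<noteq> 0"
    using f by (auto simp: strongly_starlike_def normalized_analytic_def)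
  obtain h where h: "h holomorphic_on ball 0 1" "\<And>z. cmod z < 1 \<Longrightarrow> f z = z * h z" "deriv f 0 = h 0"
    using Schwarz3[OF hol f0] by blast
  have hnz: "h z \<noteq> 0" if "z \<in> ball 0 1" for z
    using that h(2)[of z] h(3) f1 nz[of z] by (cases "z = 0") auto
  obtain g where g: "g holomorphic_on ball 0 1" "\<And>z. z \<in> ball 0 1 \<Longrightarrow> h z = exp (g z)"
    using contractible_imp_holomorphic_log[OF h(1) convex_imp_contractible[OF convex_ball] hnz] by blast
  define L where "L z = g z - g 0" for z
  have L: "L holomorphic_on ball 0 1" unfolding L_def by (intro holomorphic_intros g)
  have fL: "f z = z * exp (L z)" if "cmod z < 1" for z
    using h(2)[OF that] g(2)[of z] g(2)[of 0] h(3) f1 that by (simp add: L_def exp_diff)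
  have "starlike_quotient f z = 1 + z * deriv L z" if z: "cmod z < 1" for z
  proof -
    have dL: "(L has_field_derivative deriv L z) (at z)"
      using z by (intro holomorphic_derivI[OF L]) auto
    have "((\<lambda>z. z * exp (L z)) has_field_derivative exp (L z) + z * (exp (L z) * deriv L z)) (at z)"
      by (rule derivative_eq_intros dL refl | simp add: algebra_simps)+
    then have "(f has_field_derivative exp (L z) + z * (exp (L z) * deriv L z)) (at z)"
      by (rule has_field_derivative_transform_within_open[OF _ open_ball[of 0 1]]) (use z fL in auto)
    then show ?thesis
      using z fL[OF z] by (auto simp: starlike_quotient_def DERIV_imp_deriv field_simps)
  qed
  with L fL that show thesis by (simp add: L_def)
qed

lemma strongly_starlike_quotient_holomorphic:
  assumes f: "f \<in> strongly_starlike \<alpha>"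
  shows "starlike_quotient f holomorphic_on ball 0 1"
proof -
  obtain L where L: "L holomorphic_on ball 0 1"
    "\<And>z. cmod z < 1 \<Longrightarrow> starlike_quotient f z = 1 + z * deriv L z"
    using strongly_starlike_log_quotient[OF f] by metis
  have "(\<lambda>z. 1 + z * deriv L z) holomorphic_on ball 0 1"
    by (intro holomorphic_intros L) auto
  then show ?thesis by (rule holomorphic_transform) (use L(2) in auto)
qed

lemma strongly_starlike_quotient_Re_pos:
  assumes f: "f \<in> strongly_starlike \<alpha>" and "\<alpha> \<le> 1" and z: "cmod z < 1"
  shows "Re (starlike_quotient f z) > 0"
proof -
  have "starlike_quotient f z \<noteq> 0" "\<bar>Arg (starlike_quotient f z)\<bar> < pi * \<alpha> / 2"
    using f z by (auto simp: strongly_starlike_def)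
  moreover have "pi * \<alpha> / 2 \<le> pi / 2" using assms(2) by simp
  ultimately show ?thesis by (smt (verit) Arg_eq_Im_Ln Re_Ln_pos_lt)
qed

lemma cmod_diff_one_less_add_one:
  assumes "Re w > 0"
  shows "cmod (w - 1) < cmod (w + 1)"
proof (rule power2_less_imp_less)
  show "(cmod (w - 1))\<^sup>2 < (cmod (w + 1))\<^sup>2"
    unfolding cmod_power2 using assms by (simp add: power2_eq_square algebra_simps)
qed simp

text \<open>The power \<open>p = q powr (1/\<alpha>)\<close> has argument below \<open>\<pi>/2\<close>, so it lies in the right half-plane, and \<open>\<omega>\<close> is its
Cayley transform. The relation between \<open>q\<close> and \<open>\<omega>\<close> is kept as a differential equation: it determines the
coefficients of \<open>q\<close> recursively without expanding a power.\<close>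

lemma strongly_starlike_schwarz_function:
  assumes f: "f \<in> strongly_starlike \<alpha>" and \<alpha>: "0 < \<alpha>" "\<alpha> \<le> 1"
  defines "q \<equiv> starlike_quotient f"
  obtains \<omega> where "\<omega> holomorphic_on ball 0 1" "\<omega> 0 = 0" "\<And>z. cmod z < 1 \<Longrightarrow> cmod (\<omega> z) < 1"
    "\<And>z. cmod z < 1 \<Longrightarrow> deriv q z * (1 - (\<omega> z)\<^sup>2) = 2 * of_real \<alpha> * deriv \<omega> z * q z"
proof -
  have Re_q: "Re (q z) > 0" if "cmod z < 1" for z
    using strongly_starlike_quotient_Re_pos[OF f \<alpha>(2) that] by (simp add: q_def)
  then have q: "q z \<notin> \<real>\<^sub>\<le>\<^sub>0" "q z \<noteq> 0" if "cmod z < 1" for z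
    using that by (force simp: complex_nonpos_Reals_iff)+
  have holq: "q holomorphic_on ball 0 1"
    using strongly_starlike_quotient_holomorphic[OF f] by (simp add: q_def)
  define p where "p z = exp (Ln (q z) / of_real \<alpha>)" for z
  have holp: "p holomorphic_on ball 0 1"
    unfolding p_def using \<alpha> q by (intro holomorphic_intros holq) auto
  have Re_p: "Re (p z) > 0" if z: "cmod z < 1" for z
  proof -
    have "\<bar>Arg (q z)\<bar> < pi * \<alpha> / 2"
      using f z by (auto simp: strongly_starlike_def q_def)
    then have "\<bar>Im (Ln (q z)) / \<alpha>\<bar> < pi / 2"
      using \<alpha> q[OF z] by (simp add: Arg_eq_Im_Ln field_simps abs_divide)
    then have "cos (Im (Ln (q z)) / \<alpha>) > 0"
      by (intro cos_gt_zero_pi; linarith)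
    then show ?thesis by (simp add: p_def Re_exp)
  qed
  define \<omega> where "\<omega> z = (p z - 1) / (p z + 1)" for z
  have p1: "p z + 1 \<noteq> 0" if "cmod z < 1" for z
    using Re_p[OF that] by (metis add_eq_0_iff add.commute one_complex.sel(1) uminus_complex.sel(1)
        neg_0_less_iff_less not_one_less_zero)
  show thesis
  proof (rule that[of \<omega>])
    show "\<omega> holomorphic_on ball 0 1"
      unfolding \<omega>_def using p1 by (intro holomorphic_intros holp) auto
    show "\<omega> 0 = 0" by (simp add: \<omega>_def p_def q_def starlike_quotient_def)
    fix z :: complex
    assume z: "cmod z < 1"
    show "cmod (\<omega> z) < 1"
      using cmod_diff_one_less_add_one[OF Re_p[OF z]] p1[OF z] by (simp add: \<omega>_def norm_divide)
    have dq: "(q has_field_derivative deriv q z) (at z)"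
      using z by (intro holomorphic_derivI[OF holq]) auto
    define p' where "p' = p z * (deriv q z / q z / of_real \<alpha>)"
    have dp: "(p has_field_derivative p') (at z)"
      unfolding p_def p'_def using q[OF z] \<alpha> by (auto intro!: derivative_eq_intros dq simp: field_simps)
    have "(\<omega> has_field_derivative 2 * p' / (p z + 1)\<^sup>2) (at z)"
      unfolding \<omega>_def using p1[OF z]
      by (auto intro!: derivative_eq_intros dp simp: field_simps power2_eq_square)
    then have d\<omega>: "deriv \<omega> z = 2 * p' / (p z + 1)\<^sup>2"
      by (rule DERIV_imp_deriv)
    have \<omega>2: "1 - (\<omega> z)\<^sup>2 = 4 * p z / (p z + 1)\<^sup>2"
    proof -
      have "(p z + 1)\<^sup>2 - (p z - 1)\<^sup>2 = 4 * p z" by (simp add: power2_eq_square algebra_simps)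
      moreover have "(\<omega> z)\<^sup>2 = (p z - 1)\<^sup>2 / (p z + 1)\<^sup>2"
        unfolding \<omega>_def by (rule power_divide)
      then have "1 - (\<omega> z)\<^sup>2 = ((p z + 1)\<^sup>2 - (p z - 1)\<^sup>2) / (p z + 1)\<^sup>2"
        using p1[OF z] by (simp add: diff_divide_distrib)
      ultimately show ?thesis by simp
    qed
    show "deriv q z * (1 - (\<omega> z)\<^sup>2) = 2 * of_real \<alpha> * deriv \<omega> z * q z"
      unfolding \<omega>2 d\<omega> p'_def using p1[OF z] q[OF z] \<alpha> by (simp add: field_simps)
  qed
qed

text \<open>The Noshiro--Warschawski criterion: along the segment from \<open>a\<close> to \<open>b\<close> the real part of \<open>\<phi>/(b - a)\<close> is
strictly increasing.\<close>

lemma inj_on_of_Re_deriv_pos: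
  assumes S: "convex S" and der: "\<And>z. z \<in> S \<Longrightarrow> (\<phi> has_field_derivative \<phi>' z) (at z)"
    and pos: "\<And>z. z \<in> S \<Longrightarrow> Re (\<phi>' z) > 0"
  shows "inj_on \<phi> S"
proof (rule inj_onI, rule ccontr)
  fix a b assume ab: "a \<in> S" "b \<in> S" "\<phi> a = \<phi> b" "a \<noteq> b"
  define g where "g t = Re (\<phi> (a + of_real t * (b - a)) / (b - a))" for t :: real
  have "g 0 < g 1"
  proof (rule DERIV_pos_imp_increasing[where f = g])
    fix t :: real assume t: "0 \<le> t" "t \<le> 1"
    have "a + of_real t * (b - a) = (1 - t) *\<^sub>R a + t *\<^sub>R b"
      by (simp add: scaleR_conv_of_real algebra_simps)
    then have mem: "a + of_real t * (b - a) \<in> S"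
      using convexD_alt[OF S ab(1,2) t] by simp
    have "((\<lambda>t. \<phi> (a + of_real t * (b - a)) / (b - a)) has_vector_derivative
        \<phi>' (a + of_real t * (b - a))) (at t)"
    proof -
      have "((\<lambda>w. \<phi> (a + w * (b - a))) has_field_derivative
          \<phi>' (a + of_real t * (b - a)) * (b - a)) (at (of_real t))"
        by (rule DERIV_chain2[where f = \<phi> and g = "\<lambda>w. a + w * (b - a)", OF der[OF mem]])
          (auto intro!: derivative_eq_intros)
      from has_vector_derivative_real_field[OF DERIV_cdivide[OF this, of "b - a"]] show ?thesis
        using ab(4) by simp
    qed
    then have "(g has_vector_derivative Re (\<phi>' (a + of_real t * (b - a)))) (at t)"
      unfolding g_def
      by (rule bounded_linear.has_vector_derivative[OF bounded_linear_Re])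
    then show "\<exists>y. DERIV g t :> y \<and> y > 0"
      using pos[OF mem] by (auto simp: has_real_derivative_iff_has_vector_derivative)
  qed simp
  then show False using ab by (simp add: g_def)
qed

text \<open>The function \<open>\<phi> \<zeta> = \<zeta> + L (exp \<zeta>)\<close> satisfies \<open>exp (\<phi> \<zeta>) = f (exp \<zeta>)\<close> and \<open>\<phi>' \<zeta> = q (exp \<zeta>)\<close>, so it is injective
on the left half-plane. If \<open>f\<close> takes equal values at \<open>exp \<zeta>\<close> and \<open>exp \<zeta>'\<close>, then \<open>\<phi> \<zeta>\<close> and \<open>\<phi> \<zeta>'\<close> differ by a
period of \<open>exp\<close>; since \<open>\<phi>\<close> commutes with translation by that period, so do \<open>\<zeta>\<close> and \<open>\<zeta>'\<close>.\<close>

lemma strongly_starlike_inj_on: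
  assumes f: "f \<in> strongly_starlike \<alpha>" and \<alpha>: "\<alpha> \<le> 1"
  shows "inj_on f (ball 0 1)"
proof (rule inj_onI)
  obtain L where L: "L holomorphic_on ball 0 1" "L 0 = 0"
    "\<And>z. cmod z < 1 \<Longrightarrow> f z = z * exp (L z)"
    "\<And>z. cmod z < 1 \<Longrightarrow> starlike_quotient f z = 1 + z * deriv L z"
    using strongly_starlike_log_quotient[OF f] by blast
  define S where "S = {\<zeta>. Re \<zeta> < 0}"
  define \<phi> where "\<phi> \<zeta> = \<zeta> + L (exp \<zeta>)" for \<zeta>
  have S: "cmod (exp \<zeta>) < 1" if "\<zeta> \<in> S" for \<zeta>
    using that by (simp add: S_def)
  have inj: "inj_on \<phi> S"
  proof (rule inj_on_of_Re_deriv_pos)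
    show "convex S" unfolding S_def by (rule convex_halfspace_Re_lt)
    fix \<zeta> assume "\<zeta> \<in> S"
    note * = S[OF this]
    show "0 < Re (starlike_quotient f (exp \<zeta>))"
      by (rule strongly_starlike_quotient_Re_pos[OF f \<alpha> *])
    have "(L has_field_derivative deriv L (exp \<zeta>)) (at (exp \<zeta>))"
      using * by (intro holomorphic_derivI[OF L(1)]) auto
    from DERIV_chain2[OF this DERIV_exp] 
    show "(\<phi> has_field_derivative starlike_quotient f (exp \<zeta>)) (at \<zeta>)"
      unfolding \<phi>_def L(4)[OF *] by (auto intro!: derivative_eq_intros simp: mult.commute)
  qed
  have exp_\<phi>: "exp (\<phi> \<zeta>) = f (exp \<zeta>)" if "\<zeta> \<in> S" for \<zeta>
    using L(3)[OF S[OF that]] by (simp add: \<phi>_def exp_add)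
  fix z w assume zw: "z \<in> ball 0 1" "w \<in> ball 0 1" "f z = f w"
  then have "z = 0 \<longleftrightarrow> w = 0"
    using L(3)[of z] L(3)[of w] by auto
  moreover have "z = w" if "z \<noteq> 0" "w \<noteq> 0"
  proof -
    have mem: "Ln z \<in> S" "Ln w \<in> S" using that zw by (auto simp: S_def)
    then have "exp (\<phi> (Ln z)) = exp (\<phi> (Ln w))"
      using that zw by (simp add: exp_\<phi>)
    then obtain n :: int where "\<phi> (Ln z) = \<phi> (Ln w) + of_real (2 * of_int n * pi) * \<i>"
      unfolding exp_eq by (auto simp: mult.commute mult.left_commute)
    also have "\<dots> = \<phi> (Ln w + of_real (2 * of_int n * pi) * \<i>)"
    proof -
      have "exp (of_real (2 * of_int n * pi) * \<i> :: complex) = 1"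
        unfolding exp_eq_1 by auto
      then show ?thesis by (simp add: \<phi>_def exp_add)
    qed
    finally have *: "\<phi> (Ln z) = \<phi> (Ln w + of_real (2 * of_int n * pi) * \<i>)" .
    have mem': "Ln w + of_real (2 * of_int n * pi) * \<i> \<in> S"
      using mem(2) by (simp add: S_def)
    have "Ln z = Ln w + of_real (2 * of_int n * pi) * \<i>"
      by (rule inj_onD[OF inj * mem(1) mem'])
    then have "exp (Ln z) = exp (Ln w)" unfolding exp_eq by (intro exI[of _ n]) (simp add: ac_simps)
    then show ?thesis using that by simp
  qed
  ultimately show "z = w" by blast
qed

text \<open>Harnack's inequality, obtained from the Schwarz lemma for the Cayley transform of \<open>q\<close>.\<close>

lemma Re_ge_of_Re_pos:
  assumes hol: "q holomorphic_on ball 0 1" and q0: "q 0 = 1"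
    and pos: "\<And>z. cmod z < 1 \<Longrightarrow> Re (q z) > 0" and z: "cmod z < 1"
  shows "Re (q z) \<ge> (1 - cmod z) / (1 + cmod z)"
proof -
  have q1: "q w + 1 \<noteq> 0" if "cmod w < 1" for w
    using pos[OF that] by (metis add_eq_0_iff add.commute one_complex.sel(1) uminus_complex.sel(1)
        neg_0_less_iff_less not_one_less_zero)
  define \<omega> where "\<omega> w = (q w - 1) / (q w + 1)" for w
  have "\<omega> holomorphic_on ball 0 1"
    unfolding \<omega>_def using q1 by (intro holomorphic_intros hol) auto
  moreover have "cmod (\<omega> w) < 1" if "cmod w < 1" for w
    using cmod_diff_one_less_add_one[OF pos[OF that]] q1[OF that] by (simp add: \<omega>_def norm_divide)
  ultimately have "cmod (\<omega> z) \<le> cmod z"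
    using Schwarz_Lemma(1)[of \<omega> z] z q0 by (simp add: \<omega>_def)
  then have "cmod (q z - 1) \<le> cmod z * cmod (q z + 1)"
    using q1[OF z] by (simp add: \<omega>_def norm_divide field_simps)
  then have "(cmod (q z - 1))\<^sup>2 \<le> (cmod z * cmod (q z + 1))\<^sup>2"
    by (intro power_mono) auto
  then have "(Re (q z) - 1)\<^sup>2 + (Im (q z))\<^sup>2
      \<le> (cmod z)\<^sup>2 * (Re (q z) + 1)\<^sup>2 + (cmod z)\<^sup>2 * (Im (q z))\<^sup>2"
    by (simp add: power_mult_distrib cmod_power2[of "q z - 1"] cmod_power2[of "q z + 1"] distrib_left)
  moreover have "(cmod z)\<^sup>2 * (Im (q z))\<^sup>2 \<le> 1 * (Im (q z))\<^sup>2"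
    using z by (intro mult_right_mono) (auto simp: power_le_one)
  ultimately have "(1 - Re (q z))\<^sup>2 \<le> (cmod z * (Re (q z) + 1))\<^sup>2"
    by (simp add: power_mult_distrib power2_commute)
  then have "1 - Re (q z) \<le> cmod z * (Re (q z) + 1)"
    by (rule power2_le_imp_le) (use pos[OF z] in simp)
  then show ?thesis
    using norm_ge_zero[of z] by (simp add: pos_divide_le_eq add_pos_nonneg algebra_simps)
qed

text \<open>The radial derivative of \<open>Re L\<close> is \<open>Re (q - 1)/|z|\<close>, which Harnack's inequality bounds below by
\<open>- 2/(1 + |z|)\<close>, the derivative of \<open>- 2 ln (1 + |z|)\<close>.\<close>

lemma strongly_starlike_growth:
  assumes f: "f \<in> strongly_starlike \<alpha>" and \<alpha>: "\<alpha> \<le> 1" and z: "cmod z < 1"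
  shows "cmod z / (1 + cmod z)\<^sup>2 \<le> cmod (f z)"
proof -
  obtain L where L: "L holomorphic_on ball 0 1" "L 0 = 0"
    "\<And>z. cmod z < 1 \<Longrightarrow> f z = z * exp (L z)"
    "\<And>z. cmod z < 1 \<Longrightarrow> starlike_quotient f z = 1 + z * deriv L z"
    using strongly_starlike_log_quotient[OF f] by blast
  define r where "r = cmod z"
  have r: "0 \<le> r" "r < 1" using z by (auto simp: r_def)
  define g where "g t = Re (L (of_real t * z)) + 2 * ln (1 + t * r)" for t :: real
  have pos: "1 + t * r > 0" if "0 \<le> t" for t
    using that r by (simp add: add_pos_nonneg)
  have tz: "cmod (of_real t * z) = t * r" if "0 \<le> t" for t
    using that by (simp add: norm_mult r_def)
  have tr: "t * r < 1" if "0 \<le> t" "t \<le> 1" for t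
    using that r by (meson le_less_trans mult_left_le_one_le)
  have der: "DERIV g t :> Re (deriv L (of_real t * z) * z) + 2 * r / (1 + t * r)"
    if t: "0 \<le> t" "t \<le> 1" for t
  proof -
    have "((\<lambda>t. L (of_real t * z)) has_vector_derivative deriv L (of_real t * z) * z) (at t)"
    proof -
      have "(L has_field_derivative deriv L (of_real t * z)) (at (of_real t * z))"
        using tr[OF t] tz[OF t(1)] by (intro holomorphic_derivI[OF L(1)]) auto
      then have "((\<lambda>w. L (w * z)) has_field_derivative deriv L (of_real t * z) * z) (at (of_real t))"
        by (rule DERIV_chain2[where f = L and g = "\<lambda>w. w * z" and x = "of_real t" and s = UNIV])
          (auto intro!: derivative_eq_intros)
      then show ?thesis by (rule has_vector_derivative_real_field)
    qed
    then have "((\<lambda>t. Re (L (of_real t * z))) has_real_derivative Re (deriv L (of_real t * z) * z)) (at t)"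
      unfolding has_real_derivative_iff_has_vector_derivative
      by (rule bounded_linear.has_vector_derivative[OF bounded_linear_Re])
    moreover have "((\<lambda>t. 2 * ln (1 + t * r)) has_real_derivative 2 * r / (1 + t * r)) (at t)"
      using pos[OF t(1)] by (auto intro!: derivative_eq_intros simp: field_simps)
    ultimately show ?thesis
      unfolding g_def by (rule DERIV_add)
  qed
  have "g 0 \<le> g 1"
  proof (rule DERIV_nonneg_imp_increasing_open[where f = g])
    show "continuous_on {0..1} g"
      using der by (auto intro!: DERIV_atLeastAtMost_imp_continuous_on)
    fix t :: real assume t': "0 < t" "t < 1"
    then have t: "0 \<le> t" "t \<le> 1" by auto
    note tr = tr[OF t] and tz = tz[OF t(1)] and pos = pos[OF t(1)]
    have "0 \<le> Re (deriv L (of_real t * z) * z) + 2 * r / (1 + t * r)"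
    proof -
      have "(1 - t * r) / (1 + t * r) \<le> Re (starlike_quotient f (of_real t * z))"
        using Re_ge_of_Re_pos[OF strongly_starlike_quotient_holomorphic[OF f] _
            strongly_starlike_quotient_Re_pos[OF f \<alpha>], of "of_real t * z"] tr
        unfolding tz by (simp add: starlike_quotient_def)
      also have "\<dots> = 1 + t * Re (deriv L (of_real t * z) * z)"
        using L(4)[of "of_real t * z"] tr unfolding tz by (simp add: algebra_simps)
      also have "(1 - t * r) / (1 + t * r) = 1 - t * (2 * r / (1 + t * r))"
        using pos by (simp add: field_simps)
      finally have "0 \<le> t * (Re (deriv L (of_real t * z) * z) + 2 * r / (1 + t * r))"
        by (simp add: distrib_left)
      then show ?thesis using t' by (simp add: zero_le_mult_iff)
    qed
    then show "\<exists>y. DERIV g t :> y \<and> y \<ge> 0" using der[OF t] by blast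
  qed simp
  then have "- 2 * ln (1 + r) \<le> Re (L z)" by (simp add: g_def L(2))
  then have "exp (- 2 * ln (1 + r)) \<le> exp (Re (L z))" by simp
  also have "exp (- 2 * ln (1 + r)) = 1 / (1 + r)\<^sup>2"
    using r by (simp add: exp_minus exp_double inverse_eq_divide)
  finally have "r * (1 / (1 + r)\<^sup>2) \<le> r * exp (Re (L z))"
    using r by (intro mult_left_mono) auto
  then show ?thesis using L(3)[OF z] by (simp add: norm_mult r_def)
qed

text \<open>The boundary of the image of the disc of radius \<open>r\<close> lies in the image of the circle of radius \<open>r\<close>,
hence outside the disc of radius \<open>r/(1 + r)\<^sup>2\<close>. That disc is connected and meets the image at \<open>0\<close>, so the
image contains it; its radius tends to \<open>1/4\<close>.\<close>

lemma strongly_starlike_quarter_covering: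
  assumes f: "f \<in> strongly_starlike \<alpha>" and \<alpha>: "\<alpha> \<le> 1"
  shows "ball 0 (1/4) \<subseteq> f ` ball 0 1"
proof
  fix w :: complex assume "w \<in> ball 0 (1/4)"
  then have w: "cmod w < 1/4" by simp
  have hol: "f holomorphic_on ball 0 1" and f0: "f 0 = 0"
    using f by (auto simp: strongly_starlike_def normalized_analytic_def)
  \<comment> \<open>Any \<open>r < 1\<close> with \<open>|w| < r/(1 + r)\<^sup>2\<close> would do; this choice makes the inequality polynomial.\<close>
  define r where "r = 1/2 + 2 * cmod w"
  have r: "0 < r" "r < 1" using w by (auto simp: r_def add_pos_nonneg)
  have wr: "cmod w < r / (1 + r)\<^sup>2"
  proof -
    have "cmod w * (1 + r)\<^sup>2 < r"
    proof -
      have eq: "cmod w = (2 * r - 1) / 4" by (simp add: r_def)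
      have "0 < (1 - r) * (2 * r\<^sup>2 + 5 * r + 1)" 
      proof (intro mult_pos_pos)
        have "r \<ge> 1/2" by (simp add: r_def)
        then show "0 < 2 * r\<^sup>2 + 5 * r + 1" using zero_le_power2[of r] by linarith
      qed (use r in auto)
      then show ?thesis unfolding eq by (simp add: field_simps power2_eq_square)
    qed
    then show ?thesis using r by (simp add: pos_less_divide_eq)
  qed
  define S where "S = f ` ball 0 r"
  have sub: "ball 0 r \<subseteq> (ball 0 1 :: complex set)" "cball 0 r \<subseteq> (ball 0 1 :: complex set)" using r by auto
  have "open S"
    unfolding S_def using sub
    by (intro open_mapping_thm3 holomorphic_on_subset[OF hol] inj_on_subset[OF strongly_starlike_inj_on[OF f \<alpha>]]) auto
  have "compact (f ` cball 0 r)"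
    using sub by (intro compact_continuous_image holomorphic_on_imp_continuous_on[OF holomorphic_on_subset[OF hol]]) auto
  then have clS: "closure S \<subseteq> f ` cball 0 r"
    by (intro closure_minimal compact_imp_closed) (auto simp: S_def)
  have "w \<in> S"
  proof (rule ccontr)
    assume "w \<notin> S"
    define T where "T = ball (0::complex) (r / (1 + r)\<^sup>2)"
    have "0 \<in> T \<inter> S" using f0 r unfolding T_def S_def by (auto intro!: image_eqI[of _ _ 0])
    moreover have "w \<in> T - S" using wr \<open>w \<notin> S\<close> by (simp add: T_def)
    ultimately have "T \<inter> frontier S \<noteq> {}"
      by (intro connected_Int_frontier) (use connected_ball in \<open>unfold T_def, blast+\<close>)
    then obtain y where y: "y \<in> T" "y \<in> closure S" "y \<notin> S"
      using \<open>open S\<close> by (auto simp: frontier_def interior_open)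
    then obtain z where z: "y = f z" "cmod z \<le> r" using clS by auto
    with y(3) have "cmod z = r" by (force simp: S_def)
    then show False
      using strongly_starlike_growth[OF f \<alpha>, of z] r y(1) z(1) by (simp add: T_def)
  qed
  then show "w \<in> f ` ball 0 1" using sub by (auto simp: S_def)
qed

text \<open>The map \<open>- L\<close> composed with the inverse of \<open>f\<close> satisfies the defining conditions of the logarithm, so some
logarithm exists and the one chosen by \<open>log_inverse\<close> satisfies them too. Near \<open>0\<close> the chosen one can only
be this map, since two logarithms differ by a continuous function with values in \<open>2 \<pi> \<i> \<int>\<close>.\<close>

lemma log_inverse_comp_strongly_starlike:
  assumes f: "f \<in> strongly_starlike \<alpha>" and \<alpha>: "\<alpha> \<le> 1"
    and L: "L holomorphic_on ball 0 1" "L 0 = 0" "\<And>z. cmod z < 1 \<Longrightarrow> f z = z * exp (L z)"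
  shows "log_inverse f holomorphic_on ball 0 (1/4)"
    and "\<forall>\<^sub>F z in nhds 0. log_inverse f (f z) = - L z"
proof -
  define G where "G = the_inv_into (ball 0 1) f"
  have hol: "f holomorphic_on ball 0 1" and f0: "f 0 = 0"
    using f by (auto simp: strongly_starlike_def normalized_analytic_def)
  have inj: "inj_on f (ball 0 1)" by (rule strongly_starlike_inj_on[OF f \<alpha>])
  have G: "G (f z) = z" if "cmod z < 1" for z
    unfolding G_def using that by (intro the_inv_into_f_f[OF inj]) auto
  have cover: "ball 0 (1/4) \<subseteq> f ` ball 0 1" by (rule strongly_starlike_quarter_covering[OF f \<alpha>])
  obtain g where g: "g holomorphic_on f ` ball 0 1" "\<And>z. z \<in> ball 0 1 \<Longrightarrow> g (f z) = z"
    using holomorphic_has_inverse[OF hol open_ball inj] by metis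
  have "G holomorphic_on ball 0 (1/4)"
    by (rule holomorphic_transform[OF holomorphic_on_subset[OF g(1) cover]])
      (use cover G g(2) in force)
  moreover have "G ` ball 0 (1/4) \<subseteq> ball 0 1"
    using cover G by force
  ultimately have "(\<lambda>w. - L (G w)) holomorphic_on ball 0 (1/4)"
    by (intro holomorphic_intros holomorphic_on_compose_gen[OF _ L(1), unfolded o_def])
  moreover have "exp (- L (G w)) = G w / w" if w: "w \<in> ball 0 (1/4) - {0}" for w
  proof -
    obtain z where z: "w = f z" "cmod z < 1" using w cover by auto
    then show ?thesis using L(3)[OF z(2)] G[OF z(2)] w by (auto simp: exp_minus field_simps)
  qed
  moreover have "- L (G 0) = 0" using G[of 0] f0 L(2) by simp
  ultimately have "is_log_inverse f (\<lambda>w. - L (G w))"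
    by (simp add: is_log_inverse_def G_def)
  then have F: "is_log_inverse f (log_inverse f)"
    unfolding log_inverse_def by (rule someI[of "is_log_inverse f"])
  then show holF: "log_inverse f holomorphic_on ball 0 (1/4)" by (simp add: is_log_inverse_def)
  define D where "D z = log_inverse f (f z) + L z" for z
  have cf: "isCont f 0" and cL: "isCont L 0"
    using holomorphic_on_imp_continuous_on[OF hol] holomorphic_on_imp_continuous_on[OF L(1)]
    by (auto simp: continuous_on_eq_continuous_at)
  have "isCont (log_inverse f) (f 0)"
    using holomorphic_on_imp_continuous_on[OF holF] f0 by (auto simp: continuous_on_eq_continuous_at)
  then have "isCont (\<lambda>z. log_inverse f (f z)) 0" by (rule isCont_o2[OF cf])
  then have "isCont D 0" unfolding D_def by (rule isCont_add[OF _ cL])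
  then have tD: "(D \<longlongrightarrow> D 0) (nhds 0)" and tf: "(f \<longlongrightarrow> f 0) (nhds 0)"
    using cf by (simp_all only: isCont_def tendsto_at_iff_tendsto_nhds)
  have D0: "D 0 = 0" using F f0 L(2) by (simp add: D_def is_log_inverse_def)
  have "\<forall>\<^sub>F z in nhds 0. cmod (D z) < 1"
    using tendstoD[OF tD, of 1] by (simp add: D0 dist_norm)
  moreover have "\<forall>\<^sub>F z in nhds 0. cmod (f z) < 1/4"
    using tendstoD[OF tf, of "1/4"] by (simp add: f0 dist_norm)
  moreover have "\<forall>\<^sub>F z :: complex in nhds 0. z \<in> ball 0 1" by (rule eventually_nhds_in_open) auto
  ultimately show "\<forall>\<^sub>F z in nhds 0. log_inverse f (f z) = - L z"
  proof eventually_elim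
    case (elim z)
    have "exp (D z) = 1"
    proof (cases "z = 0")
      case True
      then show ?thesis using D0 by simp
    next
      case False
      then have "f z \<noteq> 0" using L(3)[of z] elim by auto
      then have "exp (log_inverse f (f z)) = z / f z"
        using F elim G[of z] by (simp add: is_log_inverse_def G_def)
      then show ?thesis using L(3)[of z] elim False by (simp add: D_def exp_add)
    qed
    then obtain n :: int where n: "Re (D z) = 0" "Im (D z) = of_int (2 * n) * pi"
      unfolding exp_eq_1 by auto
    have "\<bar>Im (D z)\<bar> < 1" using elim(1) abs_Im_le_cmod[of "D z"] by linarith
    then have bound: "2 * pi * \<bar>real_of_int n\<bar> < 1" unfolding n by (simp add: abs_mult ac_simps)
    have "n = 0"
    proof (rule ccontr)
      assume "n \<noteq> 0"
      then have "1 \<le> \<bar>real_of_int n\<bar>" by linarith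
      then have "2 * pi * 1 \<le> 2 * pi * \<bar>real_of_int n\<bar>" by (intro mult_left_mono) auto
      with bound show False using pi_ge_two by linarith
    qed
    then have "D z = 0" using n by (simp add: complex_eq_iff)
    then show ?case by (simp add: D_def eq_neg_iff_add_eq_0)
  qed
qed

section \<open>The Hankel determinant and its sharp bound\<close>

text \<open>Four identities of power series are compared up to order three: \<open>z f' = q f\<close> for the coefficients of \<open>f\<close>,
\<open>q = 1 + z L'\<close> for those of \<open>L\<close>, \<open>F \<circ> f = - L\<close> for those of \<open>F\<close>, and the differential equation for those of
\<open>q\<close> in terms of \<open>\<omega>\<close>. This expresses everything through the Schwarz function and bypasses the coefficients
of the inverse function.\<close>

lemma log_inverse_hankel_formula:
  assumes f: "f \<in> strongly_starlike \<alpha>" and \<alpha>: "\<alpha> \<le> 1"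
    and \<omega>: "\<omega> holomorphic_on ball 0 1" "\<omega> 0 = 0"
    and ode: "\<And>z. cmod z < 1 \<Longrightarrow> deriv (starlike_quotient f) z * (1 - (\<omega> z)\<^sup>2)
        = 2 * of_real \<alpha> * deriv \<omega> z * starlike_quotient f z"
  defines "b \<equiv> fps_nth (fps_expansion \<omega> 0)"
  shows "log_inverse_hankel f = of_real (\<alpha>\<^sup>2 / 12) *
    (4 * b 1 * b 3 - 3 * (b 2)\<^sup>2 - of_real (10 * \<alpha>) * (b 1)\<^sup>2 * b 2
      + of_real ((4 + 35 * \<alpha>\<^sup>2) / 3) * (b 1) ^ 4)"
proof -
  define q where "q = starlike_quotient f"
  obtain L where L: "L holomorphic_on ball 0 1" "L 0 = 0"
    "\<And>z. cmod z < 1 \<Longrightarrow> f z = z * exp (L z)"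
    "\<And>z. cmod z < 1 \<Longrightarrow> q z = 1 + z * deriv L z"
    using strongly_starlike_log_quotient[OF f] unfolding q_def by blast
  have holf: "f holomorphic_on ball 0 1" and f0: "f 0 = 0" and f1: "deriv f 0 = 1"
    and nz: "\<And>z. cmod z < 1 \<Longrightarrow> z \<noteq> 0 \<Longrightarrow> f z \<noteq> 0"
    using f by (auto simp: strongly_starlike_def normalized_analytic_def)
  have holq: "q holomorphic_on ball 0 1"
    unfolding q_def by (rule strongly_starlike_quotient_holomorphic[OF f])
  have F: "log_inverse f holomorphic_on ball 0 (1/4)"
    "\<forall>\<^sub>F z in nhds 0. log_inverse f (f z) = - L z"
    using log_inverse_comp_strongly_starlike[OF f \<alpha> L(1-3)] by auto
  define A \<Lambda> Q W \<Phi> where "A = fps_expansion f 0" and "\<Lambda> = fps_expansion L 0"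
    and "Q = fps_expansion q 0" and "W = fps_expansion \<omega> 0" and "\<Phi> = fps_expansion (log_inverse f) 0"
  have fps: "f has_fps_expansion A" "L has_fps_expansion \<Lambda>" "q has_fps_expansion Q"
    "\<omega> has_fps_expansion W" "log_inverse f has_fps_expansion \<Phi>"
    unfolding A_def \<Lambda>_def Q_def W_def \<Phi>_def using holf L(1) holq \<omega>(1) F(1)
    by (auto intro!: has_fps_expansion_fps_expansion[of "ball 0 1"]
        has_fps_expansion_fps_expansion[of "ball 0 (1/4)"])
  have eqI: "G = H" if "g has_fps_expansion G" "h has_fps_expansion H"
      "\<And>z. cmod z < 1 \<Longrightarrow> g z = h z" for g h :: "complex \<Rightarrow> complex" and G H
    using that(1,2)
  proof (rule has_fps_expansion_eventually_eqD)
    show "\<forall>\<^sub>F z in nhds 0. g z = h z"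
      by (rule eventually_mono[OF eventually_nhds_in_open[of "ball 0 1"]]) (use that(3) in auto)
  qed
  have A0: "fps_nth A 0 = 0" and A1: "fps_nth A 1 = 1"
    using f0 f1 by (simp_all add: A_def fps_expansion_def)
  have Q0: "fps_nth Q 0 = 1" by (simp add: Q_def q_def starlike_quotient_def)
  have W0: "fps_nth W 0 = 0" by (simp add: W_def \<omega>(2))
  have b: "b = fps_nth W" by (simp add: b_def W_def)
  have "fps_X * fps_deriv A = Q * A"
  proof (rule eqI)
    show "(\<lambda>z. z * deriv f z) has_fps_expansion fps_X * fps_deriv A"
      "(\<lambda>z. q z * f z) has_fps_expansion Q * A"
      by (intro fps_expansion_intros fps)+
    show "z * deriv f z = q z * f z" if "cmod z < 1" for z
      using f0 nz[OF that] by (simp add: q_def starlike_quotient_def)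
  qed
  then have An: "fps_nth (fps_X * fps_deriv A) n = fps_nth (Q * A) n" for n by simp
  have A2: "fps_nth A 2 = fps_nth Q 1"
    using An[of 2] A0 A1 Q0 by (simp add: fps_mult_nth numeral_2_eq_2)
  have A3: "2 * fps_nth A 3 = fps_nth Q 2 + (fps_nth Q 1)\<^sup>2"
    using An[of 3] A0 A1 A2 Q0 by (simp add: fps_mult_nth numeral_2_eq_2 numeral_3_eq_3 power2_eq_square)
  have "Q = 1 + fps_X * fps_deriv \<Lambda>"
  proof (rule eqI)
    show "(\<lambda>z. 1 + z * deriv L z) has_fps_expansion 1 + fps_X * fps_deriv \<Lambda>"
      by (intro fps_expansion_intros fps)
    show "q has_fps_expansion Q" by (rule fps)
  qed (rule L(4))
  then have \<Lambda>: "fps_nth Q (Suc n) = of_nat (Suc n) * fps_nth \<Lambda> (Suc n)" for n by simp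
  have "\<Phi> oo A = - \<Lambda>"
  proof (rule has_fps_expansion_eventually_eqD)
    show "(log_inverse f \<circ> f) has_fps_expansion (\<Phi> oo A)"
      by (intro has_fps_expansion_compose fps A0)
    show "(\<lambda>z. - L z) has_fps_expansion - \<Lambda>" by (intro fps_expansion_intros fps)
  qed (use F(2) in simp)
  then have \<Phi>n: "fps_nth (\<Phi> oo A) n = - fps_nth \<Lambda> n" for n by simp
  have \<Phi>1: "fps_nth \<Phi> 1 = - fps_nth Q 1"
    using \<Phi>n[of 1] \<Lambda>[of 0] A0 A1 by (simp add: fps_compose_nth)
  have \<Phi>2: "fps_nth \<Phi> 2 = (fps_nth Q 1)\<^sup>2 - fps_nth Q 2 / 2"
    using \<Phi>n[of 2] \<Lambda>[of 1] A0 A1 A2 \<Phi>1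
    by (simp add: fps_compose_nth numeral_2_eq_2 fps_mult_nth power2_eq_square algebra_simps)
  have \<Phi>3: "fps_nth \<Phi> 3 = - fps_nth Q 3 / 3 + 3 / 2 * fps_nth Q 1 * fps_nth Q 2
      - 3 / 2 * (fps_nth Q 1) ^ 3"
  proof -
    have "fps_nth \<Phi> 3 + 2 * fps_nth \<Phi> 2 * fps_nth A 2 + fps_nth \<Phi> 1 * fps_nth A 3 = - fps_nth Q 3 / 3"
      using \<Phi>n[of 3] \<Lambda>[of 2] A0 A1
      by (simp add: fps_compose_nth numeral_2_eq_2 numeral_3_eq_3 fps_mult_nth algebra_simps)
    moreover have "fps_nth A 3 = (fps_nth Q 2 + (fps_nth Q 1)\<^sup>2) / 2"
      using A3 by (metis nonzero_mult_div_cancel_left zero_neq_numeral)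
    ultimately show ?thesis
      unfolding \<Phi>1 \<Phi>2 A2 by (simp add: field_simps power2_eq_square power3_eq_cube)
  qed
  define e :: complex where "e = 2 * of_real \<alpha>"
  have "fps_deriv Q * (1 - W\<^sup>2) = fps_const e * fps_deriv W * Q"
  proof (rule eqI)
    show "(\<lambda>z. deriv q z * (1 - (\<omega> z)\<^sup>2)) has_fps_expansion fps_deriv Q * (1 - W\<^sup>2)"
      "(\<lambda>z. e * deriv \<omega> z * q z) has_fps_expansion fps_const e * fps_deriv W * Q"
      by (intro fps_expansion_intros fps)+
    show "deriv q z * (1 - (\<omega> z)\<^sup>2) = e * deriv \<omega> z * q z" if "cmod z < 1" for z
      using ode[OF that] by (simp add: q_def e_def)
  qed
  then have Qn: "fps_nth (fps_deriv Q * (1 - W\<^sup>2)) n = fps_nth (fps_const e * fps_deriv W * Q) n" for n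
    by simp
  have Q1: "fps_nth Q 1 = e * b 1"
    using Qn[of 0] W0 Q0 by (simp add: b fps_mult_nth power2_eq_square)
  have Q2: "fps_nth Q 2 = e * b 2 + e\<^sup>2 * (b 1)\<^sup>2 / 2"
    using Qn[of 1] W0 Q0 Q1
    by (simp add: b fps_mult_nth power2_eq_square numeral_2_eq_2 field_simps)
  have Q3: "fps_nth Q 3 = e * (b 3 + (b 1) ^ 3 / 3) + e\<^sup>2 * b 1 * b 2 + e ^ 3 * (b 1) ^ 3 / 6"
  proof -
    have "3 * fps_nth Q 3 = e * (3 * b 3 + 2 * b 2 * fps_nth Q 1 + b 1 * fps_nth Q 2)
        + fps_nth Q 1 * (b 1)\<^sup>2"
      using Qn[of 2] W0 Q0
      by (simp add: b fps_mult_nth power2_eq_square numeral_2_eq_2 numeral_3_eq_3 algebra_simps)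
    then have "fps_nth Q 3 = (e * (3 * b 3 + 2 * b 2 * fps_nth Q 1 + b 1 * fps_nth Q 2)
        + fps_nth Q 1 * (b 1)\<^sup>2) / 3"
      by (metis nonzero_mult_div_cancel_left zero_neq_numeral)
    then show ?thesis
      unfolding Q1 Q2 by (simp add: field_simps power2_eq_square power3_eq_cube)
  qed
  have "log_inverse_hankel f = e\<^sup>2 / 48 * (4 * b 1 * b 3 - 3 * (b 2)\<^sup>2 - 5 * e * (b 1)\<^sup>2 * b 2
      + (4 / 3 + 35 / 12 * e\<^sup>2) * (b 1) ^ 4)"
    unfolding log_inverse_hankel_def log_inverse_coeff_def \<Phi>_def[symmetric] \<Phi>1 \<Phi>2 \<Phi>3 Q1 Q2 Q3
    by (simp add: field_simps eval_nat_numeral)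
  then show ?thesis
    by (simp add: e_def power2_eq_square)
qed

text \<open>The coefficient estimate \<open>4 s |b\<^sub>1| \<le> s (3 + |b\<^sub>1|\<^sup>2)\<close> allows the term with \<open>y\<close> to be absorbed into
\<open>quadratic_circle_dominates\<close>; dividing the circle variable by the phase of \<open>b\<^sub>1\<^sup>2\<close> makes the coefficients
of the quadratic real.\<close>

lemma schwarz_functional_bound:
  assumes \<omega>: "\<omega> holomorphic_on ball 0 1" "\<And>z. cmod z < 1 \<Longrightarrow> cmod (\<omega> z) < 1" "\<omega> 0 = 0"
    and \<alpha>: "0 < \<alpha>" "\<alpha> \<le> 1" and K: "K = (4 + 35 * \<alpha>\<^sup>2) / 3" and BK: "K \<le> B"
    and Bq: "\<And>v. 0 \<le> v \<Longrightarrow> 3 + (10 * \<alpha> - 2) * v - (1 + 10 * \<alpha> + K) * v\<^sup>2 \<le> B"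
  defines "b \<equiv> fps_nth (fps_expansion \<omega> 0)"
  shows "cmod (4 * b 1 * b 3 - 3 * (b 2)\<^sup>2 - of_real (10 * \<alpha>) * (b 1)\<^sup>2 * b 2
      + of_real K * (b 1) ^ 4) \<le> B"
proof -
  obtain x y where b1: "cmod (b 1) \<le> 1" and x: "cmod x \<le> 1" and y: "cmod y \<le> 1 - (cmod x)\<^sup>2"
    and b2: "b 2 = of_real (1 - (cmod (b 1))\<^sup>2) * x"
    and b3: "b 3 = of_real (1 - (cmod (b 1))\<^sup>2) * (y - cnj (b 1) * x\<^sup>2)"
    using schwarz_function_coefficients[OF \<omega>] unfolding b_def by metis
  define r u s where "r = cmod (b 1)" and "u = r\<^sup>2" and "s = 1 - u"
  have r: "0 \<le> r" "r \<le> 1" using b1 by (auto simp: r_def)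
  have u: "0 \<le> u" "u \<le> 1" and s: "0 \<le> s" using r by (auto simp: u_def s_def power_le_one)
  have cb: "b 1 * cnj (b 1) = of_real u"
    by (simp only: u_def r_def complex_norm_square)
  define P where "P = s * (3 + u)"
  have P: "P \<ge> 0" using u s by (simp add: P_def)
  define a0 a1 a2 where "a0 = of_real K * (b 1) ^ 4" and "a1 = - of_real (10 * \<alpha> * s) * (b 1)\<^sup>2"
    and "a2 = - complex_of_real P"
  have "4 * b 1 * b 3 - 3 * (b 2)\<^sup>2 - of_real (10 * \<alpha>) * (b 1)\<^sup>2 * b 2 + of_real K * (b 1) ^ 4
      = (a0 + a1 * x + a2 * x\<^sup>2) + 4 * of_real s * b 1 * y"
  proof -
    have "4 * b 1 * b 3 = 4 * of_real s * b 1 * y - 4 * of_real s * (b 1 * cnj (b 1)) * x\<^sup>2"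
      unfolding b3 by (simp add: s_def u_def r_def algebra_simps)
    moreover have "b 2 = of_real s * x" unfolding b2 by (simp add: s_def u_def r_def)
    moreover have "complex_of_real P = 4 * of_real s * of_real u + 3 * (of_real s)\<^sup>2"
      by (simp add: P_def s_def algebra_simps power2_eq_square)
    ultimately show ?thesis
      unfolding cb a0_def a1_def a2_def by (simp add: algebra_simps power2_eq_square)
  qed
  then have "cmod (4 * b 1 * b 3 - 3 * (b 2)\<^sup>2 - of_real (10 * \<alpha>) * (b 1)\<^sup>2 * b 2 + of_real K * (b 1) ^ 4)
      \<le> cmod (a0 + a1 * x + a2 * x\<^sup>2) + cmod (4 * of_real s * b 1 * y)"
    by (simp add: norm_triangle_ineq)
  also have "cmod (4 * of_real s * b 1 * y) = 4 * s * r * cmod y"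
    using s by (simp add: norm_mult r_def)
  also have "\<dots> \<le> P * (1 - (cmod x)\<^sup>2)"
  proof (rule mult_mono[OF _ y P norm_ge_zero])
    have "0 \<le> s * ((1 - r) * (3 - r))" using s r by simp
    then show "4 * s * r \<le> P" by (simp add: P_def u_def algebra_simps power2_eq_square)
  qed
  also have "P = cmod a2" using P by (simp add: a2_def)
  finally have le: "cmod (4 * b 1 * b 3 - 3 * (b 2)\<^sup>2 - of_real (10 * \<alpha>) * (b 1)\<^sup>2 * b 2
      + of_real K * (b 1) ^ 4) \<le> cmod (a0 + a1 * x + a2 * x\<^sup>2) + cmod a2 * (1 - (cmod x)\<^sup>2)"
    by simp
  obtain \<zeta> where \<zeta>: "cmod \<zeta> = 1"
    "cmod (a0 + a1 * x + a2 * x\<^sup>2) + cmod a2 * (1 - (cmod x)\<^sup>2) \<le> cmod (a0 + a1 * \<zeta> + a2 * \<zeta>\<^sup>2)"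
    using quadratic_circle_dominates[OF x] by blast
  have B0: "0 \<le> B" using Bq[of 0] by simp
  have "cmod (a0 + a1 * \<zeta> + a2 * \<zeta>\<^sup>2) \<le> B"
  proof (cases "b 1 = 0")
    case True
    then show ?thesis
      using \<zeta>(1) Bq[of 0] by (simp add: a0_def a1_def a2_def P_def s_def u_def r_def norm_mult norm_power)
  next
    case False
    define c \<eta> where "c = (b 1)\<^sup>2 / of_real u" and "\<eta> = \<zeta> / c"
    have u0: "u > 0" using False by (simp add: u_def r_def)
    have c: "cmod c = 1" using u0 by (simp add: c_def u_def r_def norm_divide norm_power)
    then have \<eta>: "cmod \<eta> = 1" "\<zeta> = c * \<eta>" using \<zeta>(1) by (auto simp: \<eta>_def norm_divide)
    have b12: "(b 1)\<^sup>2 = of_real u * c" using u0 by (simp add: c_def)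
    have "(b 1) ^ 4 = ((b 1)\<^sup>2)\<^sup>2" by simp
    then have b14: "(b 1) ^ 4 = (of_real u)\<^sup>2 * c\<^sup>2" unfolding b12 by (simp add: power_mult_distrib)
    have "a0 + a1 * \<zeta> + a2 * \<zeta>\<^sup>2 = c\<^sup>2 * (of_real (K * u\<^sup>2) - of_real (10 * \<alpha> * u * s) * \<eta> - of_real P * \<eta>\<^sup>2)"
      unfolding a0_def a1_def a2_def b12 b14 \<eta>(2) by (simp add: algebra_simps power2_eq_square)
    then have "(cmod (a0 + a1 * \<zeta> + a2 * \<zeta>\<^sup>2))\<^sup>2
        = (cmod (of_real (K * u\<^sup>2) - of_real (10 * \<alpha> * u * s) * \<eta> - of_real P * \<eta>\<^sup>2))\<^sup>2"
      using c by (simp add: norm_mult norm_power)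
    also have "\<dots> \<le> B\<^sup>2"
      unfolding cmod_quadratic_on_circle[OF \<eta>(1)]
      using complex_Re_le_cmod[of \<eta>] abs_Re_le_cmod[of \<eta>] \<eta>(1)
      by (intro circle_values_bound[OF \<alpha> u _ _ K _ _ _ BK Bq]) (auto simp: P_def s_def)
    finally show ?thesis using B0 by (rule power2_le_imp_le)
  qed
  with le \<zeta>(2) show ?thesis by simp
qed



text \<open>The converse of \<open>strongly_starlike_schwarz_function\<close>: \<open>q\<close> is built as a power of the half-plane map of
\<open>\<omega>\<close>, and \<open>f = z exp g\<close> with \<open>g\<close> a primitive of \<open>(q - 1)/z\<close>.\<close>

lemma strongly_starlike_of_schwarz_function:
  assumes \<omega>: "\<omega> holomorphic_on ball 0 1" "\<And>z. cmod z < 1 \<Longrightarrow> cmod (\<omega> z) < 1" "\<omega> 0 = 0"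
    and \<alpha>: "0 < \<alpha>" "\<alpha> \<le> 1"
  obtains f where "f \<in> strongly_starlike \<alpha>"
    "\<And>z. cmod z < 1 \<Longrightarrow> deriv (starlike_quotient f) z * (1 - (\<omega> z)\<^sup>2)
        = 2 * of_real \<alpha> * deriv \<omega> z * starlike_quotient f z"
proof -
  define p where "p z = (1 + \<omega> z) / (1 - \<omega> z)" for z
  have ne: "1 - \<omega> z \<noteq> 0" "1 + \<omega> z \<noteq> 0" if "cmod z < 1" for z
    using \<omega>(2)[OF that] by (auto simp: add_eq_0_iff)
  have holp: "p holomorphic_on ball 0 1"
    unfolding p_def using ne by (intro holomorphic_intros \<omega>(1)) auto
  have Re_p: "Re (p z) > 0" if "cmod z < 1" for z
  proof -
    have "p z = (1 + \<omega> z) * cnj (1 - \<omega> z) / of_real ((cmod (1 - \<omega> z))\<^sup>2)"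
      unfolding p_def complex_norm_square using ne[OF that] by simp
    moreover have "Re ((1 + \<omega> z) * cnj (1 - \<omega> z)) = 1 - (cmod (\<omega> z))\<^sup>2"
      unfolding cmod_power2 by (simp add: algebra_simps power2_eq_square)
    ultimately have "Re (p z) = (1 - (cmod (\<omega> z))\<^sup>2) / (cmod (1 - \<omega> z))\<^sup>2"
      by (simp only: Re_divide_of_real)
    moreover have "(cmod (\<omega> z))\<^sup>2 < 1" using \<omega>(2)[OF that] by (simp add: abs_square_less_1)
    ultimately show ?thesis using ne[OF that] by simp
  qed
  then have p: "p z \<notin> \<real>\<^sub>\<le>\<^sub>0" "p z \<noteq> 0" if "cmod z < 1" for z
    using that by (force simp: complex_nonpos_Reals_iff)+
  define q where "q z = exp (of_real \<alpha> * Ln (p z))" for z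
  have holq: "q holomorphic_on ball 0 1"
    unfolding q_def using p by (intro holomorphic_intros holp) auto
  have q0: "q 0 = 1" by (simp add: q_def p_def \<omega>(3))
  obtain h where h: "h holomorphic_on ball 0 1" "\<And>z. cmod z < 1 \<Longrightarrow> q z - 1 = z * h z"
  proof -
    have "(\<lambda>z. q z - 1) holomorphic_on ball 0 1" by (intro holomorphic_intros holq)
    from Schwarz3[OF this] q0 that show thesis by auto
  qed
  obtain g where g: "\<And>z. z \<in> ball 0 1 \<Longrightarrow> (g has_field_derivative h z) (at z within ball 0 1)"
    using holomorphic_convex_primitive'[OF convex_ball open_ball h(1)] by blast
  have dg: "(g has_field_derivative h z) (at z)" if "cmod z < 1" for z
    using g[of z] that by (simp add: at_within_open[OF _ open_ball])
  define f where "f z = z * exp (g z - g 0)" for z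
  have df: "(f has_field_derivative q z * exp (g z - g 0)) (at z)" if "cmod z < 1" for z
  proof -
    have "q z = 1 + z * h z" using h(2)[OF that] by (simp add: algebra_simps)
    then show ?thesis
      unfolding f_def by (auto intro!: derivative_eq_intros dg[OF that] simp: algebra_simps)
  qed
  have sq: "starlike_quotient f z = q z" if "cmod z < 1" for z
    using DERIV_imp_deriv[OF df[OF that]] q0 by (simp add: starlike_quotient_def f_def)
  have "f \<in> strongly_starlike \<alpha>"
  proof -
    have "f holomorphic_on ball 0 1"
      unfolding holomorphic_on_open[OF open_ball] using df by (metis mem_ball_0)
    moreover have "deriv f 0 = 1" using DERIV_imp_deriv[OF df[of 0]] q0 by simp
    moreover have "\<bar>Arg (q z)\<bar> < pi * \<alpha> / 2" "q z \<noteq> 0" if "cmod z < 1" for z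
    proof -
      have bd: "\<bar>Im (Ln (p z))\<bar> < pi / 2" by (rule Re_Ln_pos_lt_imp[OF Re_p[OF that]])
      then have Im: "\<bar>Im (of_real \<alpha> * Ln (p z))\<bar> < \<alpha> * (pi / 2)" 
        using \<alpha> by (simp add: abs_mult)
      moreover have "\<alpha> * (pi / 2) \<le> 1 * (pi / 2)" using \<alpha> by (intro mult_right_mono) auto
      ultimately have "Ln (q z) = of_real \<alpha> * Ln (p z)"
        unfolding q_def using pi_gt_zero by (intro Ln_exp) linarith+
      then show "\<bar>Arg (q z)\<bar> < pi * \<alpha> / 2" "q z \<noteq> 0"
        using Im by (simp_all add: Arg_eq_Im_Ln q_def mult.commute)
    qed
    ultimately show ?thesis
      using sq by (auto simp: strongly_starlike_def normalized_analytic_def f_def)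
  qed
  moreover have "deriv (starlike_quotient f) z * (1 - (\<omega> z)\<^sup>2)
        = 2 * of_real \<alpha> * deriv \<omega> z * starlike_quotient f z" if z: "cmod z < 1" for z
  proof -
    have d\<omega>: "(\<omega> has_field_derivative deriv \<omega> z) (at z)"
      using z by (intro holomorphic_derivI[OF \<omega>(1)]) auto
    have dp: "(p has_field_derivative 2 * deriv \<omega> z / (1 - \<omega> z)\<^sup>2) (at z)"
      unfolding p_def using ne[OF z]
      by (auto intro!: derivative_eq_intros d\<omega> simp: field_simps power2_eq_square)
    have "(q has_field_derivative q z * (of_real \<alpha> * (2 * deriv \<omega> z / (1 - \<omega> z)\<^sup>2 / p z))) (at z)"
      unfolding q_def using p[OF z]
      by (auto intro!: derivative_eq_intros dp simp: field_simps)
    then have "(starlike_quotient f has_field_derivative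
        q z * (of_real \<alpha> * (2 * deriv \<omega> z / (1 - \<omega> z)\<^sup>2 / p z))) (at z)"
      by (rule has_field_derivative_transform_within_open[OF _ open_ball[of 0 1]]) (use z sq in auto)
    then have "deriv (starlike_quotient f) z = q z * (of_real \<alpha> * (2 * deriv \<omega> z / (1 - \<omega> z)\<^sup>2 / p z))"
      by (rule DERIV_imp_deriv)
    moreover have "1 - (\<omega> z)\<^sup>2 = (1 - \<omega> z) * (1 + \<omega> z)" by (simp add: algebra_simps power2_eq_square)
    ultimately have "deriv (starlike_quotient f) z * (1 - (\<omega> z)\<^sup>2) = of_real \<alpha> *
        (2 * deriv \<omega> z / (1 - \<omega> z)\<^sup>2 / p z * ((1 - \<omega> z) * (1 + \<omega> z))) * q z"
      by (simp only: mult_ac)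
    also have "2 * deriv \<omega> z / (1 - \<omega> z)\<^sup>2 / p z * ((1 - \<omega> z) * (1 + \<omega> z)) = 2 * deriv \<omega> z"
    proof -
      have "x / a\<^sup>2 / (b / a) * (a * b) = x" if "a \<noteq> 0" "b \<noteq> 0" for a b x :: complex
        using that by (simp add: field_simps power2_eq_square)
      from this[OF ne[OF z]] show ?thesis by (simp only: p_def)
    qed
    finally show ?thesis unfolding sq[OF z] by (simp only: mult_ac)
  qed
  ultimately show thesis by (rule that)
qed

text \<open>The function is \<open>z (z + c)/(1 + c z)\<close>, for which \<open>b\<^sub>1 = c\<close> and \<open>x = 1\<close>: this is the
point \<open>k = 1\<close> of the circle, where the functional has modulus \<open>|S(c\<^sup>2)|\<close>.\<close>

lemma blaschke_schwarz_function:
  fixes c :: real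
  assumes c: "0 \<le> c" "c \<le> 1"
  obtains \<omega> where "\<omega> holomorphic_on ball 0 1" "\<And>z. cmod z < 1 \<Longrightarrow> cmod (\<omega> z) < 1" "\<omega> 0 = 0"
    "fps_nth (fps_expansion \<omega> 0) 1 = of_real c"
    "fps_nth (fps_expansion \<omega> 0) 2 = of_real (1 - c\<^sup>2)"
    "fps_nth (fps_expansion \<omega> 0) 3 = - of_real (c * (1 - c\<^sup>2))"
proof -
  define \<omega> where "\<omega> z = z * (z + of_real c) / (1 + of_real c * z)" for z :: complex
  have ne: "1 + of_real c * z \<noteq> 0" if "cmod z < 1" for z
  proof
    assume "1 + of_real c * z = 0"
    then have "c * cmod z = 1"
      using c by (metis abs_of_nonneg add_eq_0_iff norm_minus_cancel norm_mult norm_of_real norm_one)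
    moreover have "c * cmod z \<le> 1 * cmod z" using c by (intro mult_right_mono) auto
    ultimately show False using that by simp
  qed
  have hol: "\<omega> holomorphic_on ball 0 1"
    unfolding \<omega>_def using ne by (intro holomorphic_intros) auto
  have lt: "cmod (\<omega> z) < 1" if z: "cmod z < 1" for z
  proof -
    have "0 \<le> (1 - c\<^sup>2) * (1 - (cmod z)\<^sup>2)" using c z by (simp add: power_le_one)
    also have "\<dots> = (cmod (1 + of_real c * z))\<^sup>2 - (cmod (z + of_real c))\<^sup>2"
      unfolding cmod_power2 by (simp add: algebra_simps power2_eq_square)
    finally have "(cmod (z + of_real c))\<^sup>2 \<le> (cmod (1 + of_real c * z))\<^sup>2" by simp
    then have "cmod (z + of_real c) \<le> cmod (1 + of_real c * z)"
      by (rule power2_le_imp_le) simp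
    then have "cmod (z + of_real c) / cmod (1 + of_real c * z) \<le> 1"
      using ne[OF z] by simp
    then have "cmod z * (cmod (z + of_real c) / cmod (1 + of_real c * z)) \<le> cmod z * 1"
      by (intro mult_left_mono) auto
    then show ?thesis using z by (simp add: \<omega>_def norm_mult norm_divide)
  qed
  have \<omega>0: "\<omega> 0 = 0" by (simp add: \<omega>_def)
  define W where "W = fps_expansion \<omega> 0"
  have W: "\<omega> has_fps_expansion W"
    unfolding W_def by (rule has_fps_expansion_fps_expansion[OF open_ball _ hol]) simp
  have eq: "W * (1 + fps_const (of_real c) * fps_X) = fps_X * (fps_X + fps_const (of_real c))"
  proof (rule has_fps_expansion_eventually_eqD)
    show "(\<lambda>z. \<omega> z * (1 + of_real c * z)) has_fps_expansion W * (1 + fps_const (of_real c) * fps_X)"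
      by (intro fps_expansion_intros W)
    show "(\<lambda>z :: complex. z * (z + of_real c)) has_fps_expansion fps_X * (fps_X + fps_const (of_real c))"
      by (intro fps_expansion_intros)
    show "\<forall>\<^sub>F z in nhds 0. \<omega> z * (1 + of_real c * z) = z * (z + of_real c)"
      by (rule eventually_mono[OF eventually_nhds_in_open[of "ball 0 1"]])
        (use ne in \<open>auto simp: \<omega>_def\<close>)
  qed
  have W0: "fps_nth W 0 = 0" by (simp add: W_def \<omega>_def)
  have Wn: "fps_nth (W * (1 + fps_const (of_real c) * fps_X)) n
      = fps_nth (fps_X * (fps_X + fps_const (of_real c))) n" for n
    using eq by simp
  have W1: "fps_nth (fps_expansion \<omega> 0) 1 = of_real c"
    using Wn[of 1] W0 unfolding W_def[symmetric] by (simp add: fps_mult_nth)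
  have W2: "fps_nth (fps_expansion \<omega> 0) 2 = of_real (1 - c\<^sup>2)"
    using Wn[of 2] W0 W1 unfolding W_def[symmetric]
    by (simp add: fps_mult_nth numeral_2_eq_2 power2_eq_square algebra_simps)
  have W3: "fps_nth (fps_expansion \<omega> 0) 3 = - of_real (c * (1 - c\<^sup>2))"
  proof -
    have "fps_nth W 3 + of_real c * fps_nth W 2 = 0"
      using Wn[of 3] W0 by (simp add: fps_mult_nth numeral_2_eq_2 numeral_3_eq_3 algebra_simps)
    then show ?thesis
      using W2 unfolding W_def[symmetric] by (simp add: add_eq_0_iff2)
  qed
  show thesis by (rule that[OF hol lt \<omega>0 W1 W2 W3])
qed

lemma strongly_starlike_hankel_bound:
  assumes f: "f \<in> strongly_starlike \<alpha>"
    and \<alpha>: "0 < \<alpha>" "\<alpha> \<le> 1" and K: "K = (4 + 35 * \<alpha>\<^sup>2) / 3" and BK: "K \<le> B"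
    and Bq: "\<And>v. 0 \<le> v \<Longrightarrow> 3 + (10 * \<alpha> - 2) * v - (1 + 10 * \<alpha> + K) * v\<^sup>2 \<le> B"
  shows "cmod (log_inverse_hankel f) \<le> \<alpha>\<^sup>2 / 12 * B"
proof -
  obtain \<omega> where \<omega>: "\<omega> holomorphic_on ball 0 1" "\<omega> 0 = 0"
    and lt: "\<And>z. cmod z < 1 \<Longrightarrow> cmod (\<omega> z) < 1"
    and ode: "\<And>z. cmod z < 1 \<Longrightarrow> deriv (starlike_quotient f) z * (1 - (\<omega> z)\<^sup>2)
        = 2 * of_real \<alpha> * deriv \<omega> z * starlike_quotient f z"
    using strongly_starlike_schwarz_function[OF f \<alpha>] by blast
  define b where "b = fps_nth (fps_expansion \<omega> 0)"
  have "cmod (log_inverse_hankel f) = cmod (of_real (\<alpha>\<^sup>2 / 12)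
      * (4 * b 1 * b 3 - 3 * (b 2)\<^sup>2 - of_real (10 * \<alpha>) * (b 1)\<^sup>2 * b 2 + of_real K * (b 1) ^ 4))"
    unfolding b_def K by (intro arg_cong[of _ _ cmod] log_inverse_hankel_formula[OF f \<alpha>(2) \<omega> ode])
  also have "\<dots> = \<alpha>\<^sup>2 / 12
      * cmod (4 * b 1 * b 3 - 3 * (b 2)\<^sup>2 - of_real (10 * \<alpha>) * (b 1)\<^sup>2 * b 2 + of_real K * (b 1) ^ 4)"
    unfolding norm_mult norm_of_real by simp
  also have "\<dots> \<le> \<alpha>\<^sup>2 / 12 * B"
    unfolding b_def
    by (intro mult_left_mono schwarz_functional_bound[OF \<omega>(1) lt \<omega>(2) \<alpha> K BK Bq]) auto
  finally show ?thesis .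
qed

lemma strongly_starlike_hankel_value:
  assumes \<alpha>: "0 < \<alpha>" "\<alpha> \<le> 1" and K: "K = (4 + 35 * \<alpha>\<^sup>2) / 3" and u: "0 \<le> u" "u \<le> 1"
  obtains f where "f \<in> strongly_starlike \<alpha>"
    "cmod (log_inverse_hankel f) = \<alpha>\<^sup>2 / 12 * \<bar>3 + (10 * \<alpha> - 2) * u - (1 + 10 * \<alpha> + K) * u\<^sup>2\<bar>"
proof -
  define c where "c = sqrt u"
  have c: "0 \<le> c" "c \<le> 1" "c\<^sup>2 = u" using u by (auto simp: c_def)
  obtain \<omega> where \<omega>: "\<omega> holomorphic_on ball 0 1" "\<And>z. cmod z < 1 \<Longrightarrow> cmod (\<omega> z) < 1" "\<omega> 0 = 0"
    "fps_nth (fps_expansion \<omega> 0) 1 = of_real c"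
    "fps_nth (fps_expansion \<omega> 0) 2 = of_real (1 - c\<^sup>2)"
    "fps_nth (fps_expansion \<omega> 0) 3 = - of_real (c * (1 - c\<^sup>2))"
    using blaschke_schwarz_function[OF c(1,2)] by blast
  obtain f where f: "f \<in> strongly_starlike \<alpha>"
    "\<And>z. cmod z < 1 \<Longrightarrow> deriv (starlike_quotient f) z * (1 - (\<omega> z)\<^sup>2)
        = 2 * of_real \<alpha> * deriv \<omega> z * starlike_quotient f z"
    using strongly_starlike_of_schwarz_function[OF \<omega>(1-3) \<alpha>] by blast
  have c4: "c ^ 4 = u\<^sup>2" using c(3) by (metis mult_2 numeral_Bit0 power_add power2_eq_square)
  define b where "b = fps_nth (fps_expansion \<omega> 0)"
  have b: "b 1 = of_real c" "b 2 = of_real (1 - c\<^sup>2)" "b 3 = - of_real (c * (1 - c\<^sup>2))"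
    using \<omega>(4-6) by (simp_all only: b_def)
  have "log_inverse_hankel f = of_real (\<alpha>\<^sup>2 / 12)
      * (4 * b 1 * b 3 - 3 * (b 2)\<^sup>2 - of_real (10 * \<alpha>) * (b 1)\<^sup>2 * b 2 + of_real K * (b 1) ^ 4)"
    unfolding b_def K by (rule log_inverse_hankel_formula[OF f(1) \<alpha>(2) \<omega>(1,3) f(2)])
  also have "\<dots> = of_real (\<alpha>\<^sup>2 / 12 * (- 4 * c\<^sup>2 * (1 - c\<^sup>2) - 3 * (1 - c\<^sup>2)\<^sup>2
      - 10 * \<alpha> * c\<^sup>2 * (1 - c\<^sup>2) + K * c ^ 4))"
    unfolding b by (simp add: power2_eq_square)
  also have "\<dots> = of_real (- (\<alpha>\<^sup>2 / 12 * (3 + (10 * \<alpha> - 2) * u - (1 + 10 * \<alpha> + K) * u\<^sup>2)))"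
    unfolding c(3) c4 by (intro arg_cong[of _ _ of_real]) (simp add: algebra_simps power2_eq_square)
  finally have H: "log_inverse_hankel f
      = of_real (- (\<alpha>\<^sup>2 / 12 * (3 + (10 * \<alpha> - 2) * u - (1 + 10 * \<alpha> + K) * u\<^sup>2)))" .
  have "cmod (log_inverse_hankel f)
      = \<alpha>\<^sup>2 / 12 * \<bar>3 + (10 * \<alpha> - 2) * u - (1 + 10 * \<alpha> + K) * u\<^sup>2\<bar>"
    unfolding H norm_of_real abs_minus_cancel abs_mult by simp
  with f(1) show thesis by (rule that)
qed

lemma threshold_root:
  obtains a' :: real where
    "\<And>x. 0 < x \<and> x < 1 \<and> 44 + 60 * x + 155 * x^2 - 1050 * x^3 - 1225 * x^4 = 0 \<longleftrightarrow> x = a'"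
    "\<bar>a' - 0.390595\<bar> < 5 / 10^7"
    "\<And>x. 0 < x \<Longrightarrow> x \<le> a' \<Longrightarrow> 0 \<le> 44 + 60 * x + 155 * x^2 - 1050 * x^3 - 1225 * x^4"
    "\<And>x. a' < x \<Longrightarrow> 44 + 60 * x + 155 * x^2 - 1050 * x^3 - 1225 * x^4 \<le> 0"
proof -
  define P where "P x = 44 + 60 * x + 155 * x^2 - 1050 * x^3 - 1225 * x^4" for x :: real
  have lo: "0 < P (3905945/10^7)" and hi: "P (3905955/10^7) < 0"
    by (simp_all add: P_def power_divide)
  have "\<exists>x. 3905945/10^7 \<le> x \<and> x \<le> 3905955/10^7 \<and> P x = 0"
    by (rule IVT2') (use lo hi in \<open>auto simp: P_def intro!: continuous_intros\<close>)
  then obtain a' where a': "3905945/10^7 \<le> a'" "a' \<le> 3905955/10^7" "P a' = 0" by blast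
  \<comment> \<open>After division by \<open>x\<^sup>3\<close> the polynomial is strictly decreasing.\<close>
  have decr: "P y * x^3 < P x * y^3" if "0 < x" "x < y" for x y
  proof -
    have "P x * y^3 - P y * x^3 = 44 * (y^3 - x^3) + 60 * x * y * (y\<^sup>2 - x\<^sup>2)
        + 155 * x\<^sup>2 * y\<^sup>2 * (y - x) + 1225 * x^3 * y^3 * (y - x)"
      unfolding P_def by (simp add: algebra_simps eval_nat_numeral)
    also have "\<dots> > 0"
      using that power_strict_mono[of x y 3] power_strict_mono[of x y 2]
      by (intro add_pos_nonneg mult_nonneg_nonneg) auto
    finally show ?thesis by simp
  qed
  have pos: "P x > 0" if "0 < x" "x < a'" for x
    using decr[OF that] a' that by (simp add: zero_less_mult_iff)
  have neg: "P x < 0" if "a' < x" for x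
    using decr[OF _ that] a' that by (simp add: mult_less_0_iff)
  show thesis
  proof (rule that[of a'])
    show "0 < x \<and> x < 1 \<and> 44 + 60 * x + 155 * x^2 - 1050 * x^3 - 1225 * x^4 = 0 \<longleftrightarrow> x = a'" for x
      using pos[of x] neg[of x] a' unfolding P_def by (cases x a' rule: linorder_cases) auto
    have "a' \<noteq> 3905945/10^7" "a' \<noteq> 3905955/10^7" using lo hi a'(3) by (metis less_irrefl)+
    then have "3905945/10^7 < a'" "a' < 3905955/10^7" using a'(1,2) by linarith+
    then show "\<bar>a' - 0.390595\<bar> < 5 / 10^7" unfolding abs_less_iff by simp
    show "0 \<le> 44 + 60 * x + 155 * x^2 - 1050 * x^3 - 1225 * x^4" if "0 < x" "x \<le> a'" for x
      using pos[OF that(1)] a'(3) that(2) unfolding P_def by (cases "x = a'") auto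
    show "44 + 60 * x + 155 * x^2 - 1050 * x^3 - 1225 * x^4 \<le> 0" if "a' < x" for x
      using neg[OF that] unfolding P_def by simp
  qed
qed

theorem theorem3p3:
  shows "\<exists>\<alpha>' :: real.
    (\<forall>x. 0 < x \<and> x < 1 \<and> 44 + 60 * x + 155 * x^2 - 1050 * x^3 - 1225 * x^4 = 0 \<longleftrightarrow> x = \<alpha>') \<and>
    \<bar>\<alpha>' - 0.390595\<bar> < 5 / 10^7 \<and>
    (\<forall>\<alpha> :: real. 0 < \<alpha> \<and> \<alpha> \<le> 1 \<longrightarrow>
      (let B = (if \<alpha> < 1 / 5 then \<alpha>^2 / 4
                else if \<alpha> \<le> \<alpha>'
                  then \<alpha>^2 * (2 + 5 * \<alpha> + 15 * \<alpha>^2) / (7 + 30 * \<alpha> + 35 * \<alpha>^2)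
                else \<alpha>^2 / 36 * (4 + 35 * \<alpha>^2))
       in (\<forall>f \<in> strongly_starlike \<alpha>. cmod (log_inverse_hankel f) \<le> B) \<and>
          (\<exists>f \<in> strongly_starlike \<alpha>. cmod (log_inverse_hankel f) = B)))"
proof -
  obtain a' :: real where a':
    "\<And>x. 0 < x \<and> x < 1 \<and> 44 + 60 * x + 155 * x^2 - 1050 * x^3 - 1225 * x^4 = 0 \<longleftrightarrow> x = a'"
    "\<bar>a' - 0.390595\<bar> < 5 / 10^7"
    "\<And>x. 0 < x \<Longrightarrow> x \<le> a' \<Longrightarrow> 0 \<le> 44 + 60 * x + 155 * x^2 - 1050 * x^3 - 1225 * x^4"
    "\<And>x. a' < x \<Longrightarrow> 44 + 60 * x + 155 * x^2 - 1050 * x^3 - 1225 * x^4 \<le> 0"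
    by (rule threshold_root) blast
  have main: "let B = (if \<alpha> < 1 / 5 then \<alpha>^2 / 4
                else if \<alpha> \<le> a'
                  then \<alpha>^2 * (2 + 5 * \<alpha> + 15 * \<alpha>^2) / (7 + 30 * \<alpha> + 35 * \<alpha>^2)
                else \<alpha>^2 / 36 * (4 + 35 * \<alpha>^2))
       in (\<forall>f \<in> strongly_starlike \<alpha>. cmod (log_inverse_hankel f) \<le> B) \<and>
          (\<exists>f \<in> strongly_starlike \<alpha>. cmod (log_inverse_hankel f) = B)"
    if \<alpha>: "0 < \<alpha>" "\<alpha> \<le> 1" for \<alpha> :: real
  proof -
    define K where "K = (4 + 35 * \<alpha>\<^sup>2) / 3"
    have K0: "K > 0" unfolding K_def by (simp add: add_pos_nonneg)
    define S where "S v = 3 + (10 * \<alpha> - 2) * v - (1 + 10 * \<alpha> + K) * v\<^sup>2" for v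
    define N where "N = 1 + 10 * \<alpha> + K"
    have N: "N > 0" using \<alpha> K0 by (simp add: N_def)
    have extremal: "(\<forall>f \<in> strongly_starlike \<alpha>. cmod (log_inverse_hankel f) \<le> \<alpha>\<^sup>2 / 12 * T) \<and>
          (\<exists>f \<in> strongly_starlike \<alpha>. cmod (log_inverse_hankel f) = \<alpha>\<^sup>2 / 12 * T)"
      if "K \<le> T" "\<And>v. 0 \<le> v \<Longrightarrow> S v \<le> T" "0 \<le> u" "u \<le> 1" "\<bar>S u\<bar> = T" for T u
    proof
      show "\<forall>f \<in> strongly_starlike \<alpha>. cmod (log_inverse_hankel f) \<le> \<alpha>\<^sup>2 / 12 * T"
        using strongly_starlike_hankel_bound[OF _ \<alpha> K_def that(1,2)[unfolded S_def]] by blast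
      show "\<exists>f \<in> strongly_starlike \<alpha>. cmod (log_inverse_hankel f) = \<alpha>\<^sup>2 / 12 * T"
        using strongly_starlike_hankel_value[OF \<alpha> K_def that(3,4), folded S_def] that(5) by metis
    qed
    \<comment> \<open>The parabola \<open>S\<close> has its vertex at \<open>v0\<close> and maximum \<open>M\<close>.\<close>
    define v0 where "v0 = (5 * \<alpha> - 1) / N"
    define M where "M = 3 + (5 * \<alpha> - 1)\<^sup>2 / N"
    have Nv0: "N * v0 = 5 * \<alpha> - 1" using N by (simp add: v0_def)
    have M_v0: "M = 3 + N * v0\<^sup>2" unfolding M_def v0_def using N by (simp add: power2_eq_square)
    have S: "S v = M - N * (v - v0)\<^sup>2" for v
    proof -
      have "S v = 3 + 2 * (N * v0) * v - N * v\<^sup>2"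
        unfolding Nv0 by (simp add: S_def N_def algebra_simps)
      then show ?thesis unfolding M_v0 by (simp add: algebra_simps power2_eq_square)
    qed
    have SM: "S v \<le> M" for v unfolding S using N by simp
    have SK: "S 1 = - K" unfolding S_def by simp
    have M': "M = 12 * (2 + 5 * \<alpha> + 15 * \<alpha>\<^sup>2) / (7 + 30 * \<alpha> + 35 * \<alpha>\<^sup>2)"
    proof -
      have "3 * N = 7 + 30 * \<alpha> + 35 * \<alpha>\<^sup>2" by (simp add: N_def K_def)
      moreover have "M = (3 * (3 * N) + 3 * (5 * \<alpha> - 1)\<^sup>2) / (3 * N)"
        unfolding M_def using N by (simp add: field_simps)
      ultimately show ?thesis by (simp add: power2_eq_square algebra_simps)
    qed
    have den: "7 + 30 * \<alpha> + 35 * \<alpha>\<^sup>2 > 0" using \<alpha> by (simp add: add_pos_nonneg)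
    have MK: "M - K = (44 + 60 * \<alpha> + 155 * \<alpha>^2 - 1050 * \<alpha>^3 - 1225 * \<alpha>^4)
        / (3 * (7 + 30 * \<alpha> + 35 * \<alpha>\<^sup>2))"
      unfolding M' K_def using den by (simp add: field_simps) (simp add: algebra_simps eval_nat_numeral)
    consider "\<alpha> < 1/5" | "1/5 \<le> \<alpha>" "\<alpha> \<le> a'" | "1/5 \<le> \<alpha>" "a' < \<alpha>" by linarith
    then show ?thesis
    proof cases
      case 1
      have "\<alpha>\<^sup>2 \<le> (1/5)\<^sup>2" using 1 \<alpha> by (intro power_mono) auto
      then have "K \<le> 3" by (simp add: K_def power_divide)
      moreover have "S v \<le> 3" if "0 \<le> v" for v
      proof -
        have "(10 * \<alpha> - 2) * v \<le> 0" using 1 that by (simp add: mult_nonpos_nonneg)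
        moreover have "0 \<le> N * v\<^sup>2" using N by simp
        ultimately show ?thesis by (simp add: S_def N_def)
      qed
      ultimately show ?thesis using extremal[of 3 0] 1 by (simp add: S_def)
    next
      case 2
      have "v0 \<ge> 0" using 2 N by (simp add: v0_def)
      moreover have "v0 \<le> 1" using \<alpha> N K0 by (simp add: v0_def N_def)
      moreover have "0 \<le> M - K"
        unfolding MK using a'(3)[OF \<alpha>(1) 2(2)] den by (intro divide_nonneg_pos) auto
      moreover have "\<bar>S v0\<bar> = M"
        unfolding S using N by (simp add: M_def add_nonneg_nonneg)
      ultimately have ext: "(\<forall>f \<in> strongly_starlike \<alpha>. cmod (log_inverse_hankel f) \<le> \<alpha>\<^sup>2 / 12 * M) \<and>
          (\<exists>f \<in> strongly_starlike \<alpha>. cmod (log_inverse_hankel f) = \<alpha>\<^sup>2 / 12 * M)"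
        by (intro extremal[of M v0] SM) linarith+
      have "x / 12 * (12 * y / w) = x * y / w" for x y w :: real by simp
      then have eq: "\<alpha>\<^sup>2 / 12 * M = \<alpha>\<^sup>2 * (2 + 5 * \<alpha> + 15 * \<alpha>\<^sup>2) / (7 + 30 * \<alpha> + 35 * \<alpha>\<^sup>2)"
        unfolding M' .
      show ?thesis
        using ext unfolding eq Let_def if_not_P[OF leD[OF 2(1)]] if_P[OF 2(2)] .
    next
      case 3
      have "M - K \<le> 0"
        unfolding MK using a'(4)[OF 3(2)] den by (intro divide_nonpos_pos) auto
      then have "S v \<le> K" for v using SM[of v] by linarith
      then show ?thesis
        using extremal[of K 1] SK K0 3 by (simp add: K_def)
    qed
  qed
  show ?thesis
    using a'(1,2) main by (intro exI[of _ a'] conjI allI impI) blast+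
qed


end
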